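(* Let $k$ be a field of characteristic zero and $R=k[s,t,x,y,z]$, bigraded with $\deg s=\deg t=(1,0)$ and $\deg x=\deg y=\deg z=(0,1)$. Let $n\ge 2$, let $A_1,\dots,A_n\in R_{(1,0)}$ and $B_1,\dots,B_n\in R_{(0,1)}$ be nonzero, let $m\ge 0$ be an integer, and let $$Z=\mathbb V(A_1,B_1)+\cdots+\mathbb V(A_n,B_n)+m\cdot\mathbb V(B_1,B_2)\subseteq\mathbb P^1\times\mathbb P^2,$$ i.e. $I_Z=(A_1,B_1)\cap\cdots\cap(A_n,B_n)\cap(B_1,B_2)^m$. Assume: (1) $\mathbb V(A_{n-1})\neq\mathbb V(A_n)$; (2) $\mathbb V(B_i)\neq\mathbb V(B_j)$ for $i\neq j$; (3) $\mathbb V(B_1,\dots,B_n)=\mathbb V(B_1,B_2)$, i.e. every $B_i$ lies in the $k$-span of $B_1,B_2$. Then $Z$ is ACM (i.e. $R/I_Z$ is Cohen–Macaulay) if and only if $m\ge n-1$.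
   Context: $\mathbb V(A_i,B_i)$ is a (horizontal) line of $\mathbb P^1\times\mathbb P^2$ with ideal $(A_i,B_i)$, and $\mathbb V(B_1,B_2)$ is a (vertical) line with ideal $(B_1,B_2)$; $m\cdot\mathbb V(B_1,B_2)$ denotes the fat line with ideal $(B_1,B_2)^m$ (absent if $m=0$). *)

theory Defs
  imports Main "HOL-Library.Poly_Mapping" "HOL-Library.Extended_Nat"
begin

datatype var = S | T | X | Y | Z

type_synonym 'k mpoly5 = "(var \<Rightarrow>\<^sub>0 nat) \<Rightarrow>\<^sub>0 'k"

definition Var :: "var \<Rightarrow> 'k::comm_ring_1 mpoly5" where
  "Var v = Poly_Mapping.single (Poly_Mapping.single v 1) 1"

definition bihomog :: "nat \<Rightarrow> nat \<Rightarrow> 'k::comm_ring_1 mpoly5 \<Rightarrow> bool" where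
  "bihomog d e p \<longleftrightarrow> (\<forall>mo \<in> Poly_Mapping.keys p.
      Poly_Mapping.lookup mo S + Poly_Mapping.lookup mo T = d \<and> Poly_Mapping.lookup mo X + Poly_Mapping.lookup mo Y + Poly_Mapping.lookup mo Z = e)"

definition eval5 :: "'k::comm_ring_1 mpoly5 \<Rightarrow> (var \<Rightarrow> 'k) \<Rightarrow> 'k" where
  "eval5 p pt = (\<Sum>mo \<in> Poly_Mapping.keys p. Poly_Mapping.lookup p mo * (\<Prod>v \<in> {S,T,X,Y,Z}. pt v ^ Poly_Mapping.lookup mo v))"

text \<open>Zero locus in P^1 x P^2 (over k), represented by its affine multi-cone:
  points (s,t;x,y,z) with (s,t) \<noteq> 0 and (x,y,z) \<noteq> 0 at which all of F vanish.\<close>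
definition bizero :: "'k::comm_ring_1 mpoly5 set \<Rightarrow> (var \<Rightarrow> 'k) set" where
  "bizero F = {pt. (pt S \<noteq> 0 \<or> pt T \<noteq> 0) \<and> (pt X \<noteq> 0 \<or> pt Y \<noteq> 0 \<or> pt Z \<noteq> 0)
                   \<and> (\<forall>f \<in> F. eval5 f pt = 0)}"

definition is_ideal :: "'a::comm_ring_1 set \<Rightarrow> bool" where
  "is_ideal I \<longleftrightarrow> 0 \<in> I \<and> (\<forall>a\<in>I. \<forall>b\<in>I. a + b \<in> I) \<and> (\<forall>r. \<forall>a\<in>I. r * a \<in> I)"

definition gen_ideal :: "'a::comm_ring_1 set \<Rightarrow> 'a set" where
  "gen_ideal F = \<Inter>{J. is_ideal J \<and> F \<subseteq> J}"

definition ideal_mult :: "'a::comm_ring_1 set \<Rightarrow> 'a set \<Rightarrow> 'a set" where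
  "ideal_mult I J = gen_ideal {a * b | a b. a \<in> I \<and> b \<in> J}"

fun ideal_pow :: "'a::comm_ring_1 set \<Rightarrow> nat \<Rightarrow> 'a set" where
  "ideal_pow I 0 = UNIV"
| "ideal_pow I (Suc m) = ideal_mult I (ideal_pow I m)"

definition prime_ideal :: "'a::comm_ring_1 set \<Rightarrow> bool" where
  "prime_ideal P \<longleftrightarrow> is_ideal P \<and> P \<noteq> UNIV \<and> (\<forall>a b. a * b \<in> P \<longrightarrow> a \<in> P \<or> b \<in> P)"

definition krull_dim_quot :: "'a::comm_ring_1 set \<Rightarrow> enat" where
  "krull_dim_quot I = Sup {enat n | n. \<exists>P :: nat \<Rightarrow> 'a set.
       (\<forall>i\<le>n. prime_ideal (P i) \<and> I \<subseteq> P i) \<and> (\<forall>i<n. P i \<subset> P (Suc i))}"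

definition irrel :: "'k::comm_ring_1 mpoly5 set" where
  "irrel = gen_ideal (Var ` UNIV)"

definition regular_seq :: "'k::comm_ring_1 mpoly5 set \<Rightarrow> 'k mpoly5 list \<Rightarrow> bool" where
  "regular_seq I fs \<longleftrightarrow> set fs \<subseteq> irrel \<and> gen_ideal (I \<union> set fs) \<noteq> UNIV \<and>
     (\<forall>i < length fs. \<forall>g. fs ! i * g \<in> gen_ideal (I \<union> set (take i fs))
                            \<longrightarrow> g \<in> gen_ideal (I \<union> set (take i fs)))"

definition depth_quot :: "'k::comm_ring_1 mpoly5 set \<Rightarrow> enat" where
  "depth_quot I = Sup {enat (length fs) | fs. regular_seq I fs}"

text \<open>R/I (I homogeneous) is Cohen-Macaulay: depth_m(R/I) = dim(R/I).\<close>
definition cohen_macaulay_quot :: "'k::comm_ring_1 mpoly5 set \<Rightarrow> bool" where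
  "cohen_macaulay_quot I \<longleftrightarrow> depth_quot I = krull_dim_quot I"

end

theory Submission
  imports Defs "HOL-Computational_Algebra.Polynomial"
begin

text \<open>
  After a linear change of coordinates the ideals are \<open>(t - a\<^sub>i l, y - b\<^sub>i x)\<close> and \<open>(x, y)\<^sup>m\<close>, with \<open>z\<close>
  a fifth coordinate; membership in each of them is tested by a substitution homomorphism.
  The quotient has dimension three, and \<open>z, l\<close> is always a regular sequence on it.

  If \<open>m \<ge> n - 1\<close>, then \<open>(x, y)\<^sup>m\<close> is contained in the ideal generated by the products
  \<open>\<Prod>\<^bsub>j \<noteq> i\<^esub> (y - b\<^sub>j x)\<close>; hence modulo \<open>(z, l)\<close> the ideal becomes \<open>(x, y)\<^sup>m \<inter> (t, \<Prod>\<^sub>i (y - b\<^sub>i x))\<close>,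
  and \<open>t + x\<close> extends the regular sequence.  If \<open>m < n - 1\<close>, then
  \<open>(t - a\<^bsub>n-1\<^esub> l) \<Prod>\<^bsub>i \<le> n-2\<^esub> (y - b\<^sub>i x)\<close> is a nonzero socle element modulo \<open>(z, l)\<close>, and a
  Koszul-type argument excludes every regular sequence of length three.

  The upper bounds on dimension and depth both follow from one fact: any four polynomials satisfy
  an algebraic relation modulo the ideal, and reading off the lexicographically smallest monomial
  of this relation contradicts a chain of five primes as well as a regular sequence of length four.
\<close>

section \<open>Ideals\<close>

text \<open>The bound \<open>n - 1\<close> comes from counting binary forms. The products of
  \<open>n - 1\<close> out of \<open>n\<close> pairwise non-proportional linear forms in
  \<open>x\<close>, \<open>y\<close> generate \<open>(x, y)^(n-1)\<close>, whereas the socle element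
  has degree \<open>n - 2\<close> in \<open>x\<close>, \<open>y\<close> and so lies in
  \<open>(x, y)^m\<close> as long as \<open>m \<le> n - 2\<close>. Its value on the last line
  carries the factor \<open>a n - a (n - 1)\<close>, which is where assumption (1) enters. The depth
  is a supremum over all regular sequences in the irrelevant ideal, homogeneous or not. A socle
  element modulo \<open>z, l\<close> shows that this one sequence cannot be prolonged; the
  Koszul-type argument transfers the obstruction to every other sequence, in place of the general
  theorem on the common length of maximal regular sequences.\<close>

lemma is_ideal_zero: "is_ideal J \<Longrightarrow> 0 \<in> J"
  and is_ideal_add: "is_ideal J \<Longrightarrow> a \<in> J \<Longrightarrow> b \<in> J \<Longrightarrow> a + b \<in> J"
  and is_ideal_mult_left: "is_ideal J \<Longrightarrow> a \<in> J \<Longrightarrow> r * a \<in> J"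
  and is_ideal_mult_right: "is_ideal J \<Longrightarrow> a \<in> J \<Longrightarrow> a * r \<in> J"
  by (auto simp: is_ideal_def mult.commute[of a r])

lemma is_ideal_minus: "is_ideal J \<Longrightarrow> a \<in> J \<Longrightarrow> - a \<in> J"
  using is_ideal_mult_left[of J a "-1"] by simp

lemma is_ideal_diff: "is_ideal J \<Longrightarrow> a \<in> J \<Longrightarrow> b \<in> J \<Longrightarrow> a - b \<in> J"
  using is_ideal_add[of J a "-b"] is_ideal_minus by force

lemma is_ideal_diff_cancel: "is_ideal J \<Longrightarrow> a - b \<in> J \<Longrightarrow> b \<in> J \<Longrightarrow> a \<in> J"
  using is_ideal_add[of J "a - b" b] by simp

lemma is_ideal_gen [simp, intro]: "is_ideal (gen_ideal F)"
  unfolding gen_ideal_def is_ideal_def by auto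

lemma gen_ideal_superset: "F \<subseteq> gen_ideal F"
  unfolding gen_ideal_def by auto

lemma gen_ideal_base: "f \<in> F \<Longrightarrow> f \<in> gen_ideal F"
  using gen_ideal_superset by blast

lemma gen_ideal_least: "is_ideal J \<Longrightarrow> F \<subseteq> J \<Longrightarrow> gen_ideal F \<subseteq> J"
  unfolding gen_ideal_def by auto

lemma gen_ideal_mono: "F \<subseteq> G \<Longrightarrow> gen_ideal F \<subseteq> gen_ideal G"
  unfolding gen_ideal_def by auto

lemma gen_ideal_ideal [simp]: "is_ideal J \<Longrightarrow> gen_ideal J = J"
  using gen_ideal_least[of J J] gen_ideal_superset[of J] by auto

lemma is_ideal_UNIV [simp]: "is_ideal UNIV"
  by (simp add: is_ideal_def)

lemma is_ideal_Int: "is_ideal I \<Longrightarrow> is_ideal J \<Longrightarrow> is_ideal (I \<inter> J)"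
  by (auto simp: is_ideal_def)

lemma is_ideal_INT: "(\<And>i. i \<in> N \<Longrightarrow> is_ideal (J i)) \<Longrightarrow> is_ideal (\<Inter>i\<in>N. J i)"
  by (auto simp: is_ideal_def)

lemma ideal_eq_UNIV: "is_ideal J \<Longrightarrow> 1 \<in> J \<Longrightarrow> J = UNIV"
  using is_ideal_mult_left[of J 1] by auto

lemma gen_ideal_insert:
  assumes "is_ideal J"
  shows "x \<in> gen_ideal (insert f J) \<longleftrightarrow> (\<exists>a. x - a * f \<in> J)"
proof
  let ?K = "{x. \<exists>a. x - a * f \<in> J}"
  have "is_ideal ?K"
    unfolding is_ideal_def
  proof (intro conjI ballI allI)
    show "0 \<in> ?K" using is_ideal_zero[OF assms] by (auto intro: exI[of _ 0])
  next
    fix x y assume "x \<in> ?K" "y \<in> ?K"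
    then obtain a b where "x - a * f \<in> J" "y - b * f \<in> J" by auto
    then have "(x - a * f) + (y - b * f) \<in> J" by (rule is_ideal_add[OF assms])
    moreover have "(x - a * f) + (y - b * f) = (x + y) - (a + b) * f" by (simp add: algebra_simps)
    ultimately show "x + y \<in> ?K" by (auto intro!: exI[of _ "a + b"])
  next
    fix r x assume "x \<in> ?K"
    then obtain a where "x - a * f \<in> J" by auto
    then have "r * (x - a * f) \<in> J" by (rule is_ideal_mult_left[OF assms])
    then show "r * x \<in> ?K" by (auto intro!: exI[of _ "r * a"] simp: algebra_simps)
  qed
  moreover have "insert f J \<subseteq> ?K"
    using is_ideal_zero[OF assms] by (auto intro: exI[of _ 1] exI[of _ 0])
  ultimately have "gen_ideal (insert f J) \<subseteq> ?K" by (rule gen_ideal_least)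
  moreover assume "x \<in> gen_ideal (insert f J)"
  ultimately show "\<exists>a. x - a * f \<in> J" by auto
next
  assume "\<exists>a. x - a * f \<in> J"
  then obtain a where "x - a * f \<in> J" by auto
  then have "x - a * f \<in> gen_ideal (insert f J)" by (simp add: gen_ideal_base)
  moreover have "a * f \<in> gen_ideal (insert f J)"
    by (simp add: gen_ideal_base is_ideal_mult_left)
  ultimately show "x \<in> gen_ideal (insert f J)" by (rule is_ideal_diff_cancel[OF is_ideal_gen])
qed

lemma gen_ideal_Un: "gen_ideal (gen_ideal F \<union> G) = gen_ideal (F \<union> G)"
proof
  show "gen_ideal (gen_ideal F \<union> G) \<subseteq> gen_ideal (F \<union> G)"
    using gen_ideal_mono[of F "F \<union> G"] gen_ideal_superset[of "F \<union> G"]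
    by (intro gen_ideal_least) auto
  show "gen_ideal (F \<union> G) \<subseteq> gen_ideal (gen_ideal F \<union> G)"
    using gen_ideal_superset[of F] by (intro gen_ideal_mono) auto
qed

lemma gen_ideal_insert_gen: "gen_ideal (insert f (gen_ideal F)) = gen_ideal (insert f F)"
  using gen_ideal_Un[of F "{f}"] by simp

lemma gen_ideal_empty [simp]: "gen_ideal {} = {0}"
proof -
  have "is_ideal {0}" by (simp add: is_ideal_def)
  then show ?thesis using gen_ideal_least[of "{0}" "{}"] is_ideal_zero[OF is_ideal_gen] by auto
qed

lemma gen_ideal_single: "x \<in> gen_ideal {f} \<longleftrightarrow> f dvd x"
proof -
  have "is_ideal {0}" by (simp add: is_ideal_def)
  then have "x \<in> gen_ideal (insert f {0}) \<longleftrightarrow> (\<exists>a. x = a * f)"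
    by (subst gen_ideal_insert) auto
  moreover have "gen_ideal (insert f {0}) = gen_ideal {f}"
    using gen_ideal_insert_gen[of f "{}"] by simp
  ultimately show ?thesis by (auto simp: dvd_def mult.commute)
qed

lemma ideal_mult_mem: "a \<in> I \<Longrightarrow> b \<in> J \<Longrightarrow> a * b \<in> ideal_mult I J"
  unfolding ideal_mult_def by (rule gen_ideal_base) auto

lemma is_ideal_pow [simp, intro]: "is_ideal (ideal_pow I m)"
  by (cases m) (auto simp: ideal_mult_def)

lemma ideal_pow_Suc_mem: "a \<in> I \<Longrightarrow> b \<in> ideal_pow I m \<Longrightarrow> a * b \<in> ideal_pow I (Suc m)"
  by (simp only: ideal_pow.simps ideal_mult_mem)

lemma ideal_pow_Suc_least:
  assumes "is_ideal J" "\<And>a b. a \<in> I \<Longrightarrow> b \<in> ideal_pow I m \<Longrightarrow> a * b \<in> J"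
  shows "ideal_pow I (Suc m) \<subseteq> J"
  using assms unfolding ideal_pow.simps ideal_mult_def by (intro gen_ideal_least) auto

lemma ideal_pow_Suc_subset: "ideal_pow I (Suc m) \<subseteq> ideal_pow I m"
  by (rule ideal_pow_Suc_least) (auto intro: is_ideal_mult_left)

lemma ideal_pow_antimono: "m \<le> m' \<Longrightarrow> ideal_pow I m' \<subseteq> ideal_pow I m"
  by (induction rule: dec_induct) (use ideal_pow_Suc_subset in blast)+

lemma power_mem_ideal_pow: "a \<in> I \<Longrightarrow> a ^ m \<in> ideal_pow I m"
  by (induction m) (auto intro: ideal_mult_mem)

lemma prod_mem_ideal_pow:
  assumes "finite N" "\<And>i. i \<in> N \<Longrightarrow> f i \<in> I"
  shows "prod f N \<in> ideal_pow I (card N)"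
  using assms by (induction rule: finite_induct) (auto intro: ideal_mult_mem)

section \<open>Ring homomorphisms\<close>

definition is_hom :: "('a::comm_ring_1 \<Rightarrow> 'b::comm_ring_1) \<Rightarrow> bool" where
  "is_hom h \<longleftrightarrow> h 1 = 1 \<and> (\<forall>a b. h (a + b) = h a + h b) \<and> (\<forall>a b. h (a * b) = h a * h b)"

lemma is_hom_one: "is_hom h \<Longrightarrow> h 1 = 1"
  and is_hom_add: "is_hom h \<Longrightarrow> h (a + b) = h a + h b"
  and is_hom_mult: "is_hom h \<Longrightarrow> h (a * b) = h a * h b"
  by (auto simp: is_hom_def)

lemma is_hom_zero: "is_hom h \<Longrightarrow> h 0 = 0"
  using is_hom_add[of h 0 0] by simp

lemma is_hom_minus: "is_hom h \<Longrightarrow> h (- a) = - h a"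
  using is_hom_add[of h a "-a"] is_hom_zero[of h] by (simp add: eq_neg_iff_add_eq_0 add.commute)

lemma is_hom_diff: "is_hom h \<Longrightarrow> h (a - b) = h a - h b"
  using is_hom_add[of h a "-b"] is_hom_minus[of h b] by simp

lemma is_hom_prod: "is_hom h \<Longrightarrow> h (prod f N) = (\<Prod>i\<in>N. h (f i))"
  by (induction N rule: infinite_finite_induct) (auto simp: is_hom_one is_hom_mult)

lemma is_hom_power: "is_hom h \<Longrightarrow> h (a ^ k) = h a ^ k"
  by (induction k) (auto simp: is_hom_one is_hom_mult)

lemma is_hom_comp: "is_hom g \<Longrightarrow> is_hom h \<Longrightarrow> is_hom (\<lambda>a. g (h a))"
  by (simp add: is_hom_def)

lemma is_ideal_vimage: "is_hom h \<Longrightarrow> is_ideal J \<Longrightarrow> is_ideal (h -` J)"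
  by (auto simp: is_ideal_def is_hom_zero is_hom_add is_hom_mult)

lemma is_ideal_kernel: "is_hom h \<Longrightarrow> is_ideal {f. h f = 0}"
  by (auto simp: is_ideal_def is_hom_zero is_hom_add is_hom_mult)

lemma prime_ideal_kernel:
  fixes h :: "'a::comm_ring_1 \<Rightarrow> 'b::idom"
  assumes "is_hom h"
  shows "prime_ideal {f. h f = 0}"
proof -
  have "1 \<notin> {f. h f = 0}" by (simp add: is_hom_one[OF assms])
  then have "{f. h f = 0} \<noteq> UNIV" by blast
  then show ?thesis
    unfolding prime_ideal_def by (auto simp: is_ideal_kernel is_hom_mult assms)
qed

lemma is_hom_gen_ideal:
  assumes "is_hom h" "h ` F \<subseteq> gen_ideal G" "f \<in> gen_ideal F"
  shows "h f \<in> gen_ideal G"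
proof -
  have "gen_ideal F \<subseteq> h -` gen_ideal G"
    using assms by (intro gen_ideal_least is_ideal_vimage) auto
  then show ?thesis using assms by auto
qed

lemma is_hom_ideal_pow:
  assumes "is_hom h" "h ` I \<subseteq> J" "f \<in> ideal_pow I m"
  shows "h f \<in> ideal_pow J m"
proof -
  have "ideal_pow I m \<subseteq> h -` ideal_pow J m"
  proof (induction m)
    case (Suc m)
    show ?case
    proof (rule ideal_pow_Suc_least)
      fix a b assume "a \<in> I" "b \<in> ideal_pow I m"
      then have "h a * h b \<in> ideal_pow J (Suc m)"
        using Suc assms(2) by (intro ideal_pow_Suc_mem) auto
      then show "a * b \<in> h -` ideal_pow J (Suc m)" by (simp only: vimage_eq is_hom_mult[OF assms(1)])
    qed (intro is_ideal_vimage assms is_ideal_pow)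
  qed simp
  then show ?thesis using assms by auto
qed

section \<open>Regular sequences of length three\<close>

definition nzd_mod :: "'a::comm_ring_1 set \<Rightarrow> 'a \<Rightarrow> bool" where
  "nzd_mod J f \<longleftrightarrow> (\<forall>g. f * g \<in> J \<longrightarrow> g \<in> J)"

lemma nzd_modD: "nzd_mod J f \<Longrightarrow> f * g \<in> J \<Longrightarrow> g \<in> J"
  by (auto simp: nzd_mod_def)

text \<open>Koszul-type argument: the pairwise relations among lifts of \<open>f\<^sub>i G / l\<close> modulo \<open>z\<close> force
  the socle element \<open>G\<close> to be divisible by \<open>l\<close>.\<close>
lemma no_regular_triple:
  fixes J :: "'a::comm_ring_1 set"
  assumes J: "is_ideal J"
    and f1: "nzd_mod J f1" and f2: "nzd_mod (gen_ideal (insert f1 J)) f2"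
    and f3: "nzd_mod (gen_ideal (insert f2 (insert f1 J))) f3"
    and z: "nzd_mod J z" and l: "nzd_mod (gen_ideal (insert z J)) l"
    and G1: "f1 * G \<in> gen_ideal (insert l (insert z J))"
    and G2: "f2 * G \<in> gen_ideal (insert l (insert z J))"
    and G3: "f3 * G \<in> gen_ideal (insert l (insert z J))"
  shows "G \<in> gen_ideal (insert l (insert z J))"
proof -
  \<comment> \<open>All computations take place modulo \<open>J\<close>. Written as a congruence,
    membership in an ideal with one or two extra generators becomes an explicit linear
    combination.\<close>
  define E where "E = (\<lambda>a b. a - b \<in> J)"
  have E_refl: "E a a" for a using is_ideal_zero[OF J] by (simp add: E_def)
  have E_sym: "E a b \<Longrightarrow> E b a" for a b using is_ideal_minus[OF J, of "a - b"] by (simp add: E_def)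
  have E_trans: "E a b \<Longrightarrow> E b c \<Longrightarrow> E a c" for a b c
    using is_ideal_add[OF J, of "a - b" "b - c"] by (simp add: E_def)
  have E_add: "E a b \<Longrightarrow> E c d \<Longrightarrow> E (a + c) (b + d)" for a b c d
    using is_ideal_add[OF J, of "a - b" "c - d"] by (simp add: E_def algebra_simps)
  have E_mult: "E a b \<Longrightarrow> E (r * a) (r * b)" for a b r
    using is_ideal_mult_left[OF J, of "a - b" r] by (simp add: E_def algebra_simps)
  have E_diff: "E a b \<Longrightarrow> E c d \<Longrightarrow> E (a - c) (b - d)" for a b c d
    using E_add[of a b "-c" "-d"] E_mult[of c d "-1"] by simp
  have mem1: "x \<in> gen_ideal (insert f J) \<longleftrightarrow> (\<exists>a. E x (a * f))" for x f
    by (simp add: gen_ideal_insert[OF J] E_def)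
  have mem2: "x \<in> gen_ideal (insert g (insert f J)) \<longleftrightarrow> (\<exists>a b. E x (a * g + b * f))" for x f g
  proof -
    have "gen_ideal (insert g (insert f J)) = gen_ideal (insert g (gen_ideal (insert f J)))"
      by (rule gen_ideal_insert_gen[symmetric])
    then show ?thesis
      by (simp add: gen_ideal_insert gen_ideal_insert[OF J] E_def algebra_simps)
  qed
  have f1c: "E a b" if "E (f1 * a) (f1 * b)" for a b
    using nzd_modD[OF f1, of "a - b"] that by (simp add: E_def algebra_simps)
  have zc: "E a b" if "E (z * a) (z * b)" for a b
    using nzd_modD[OF z, of "a - b"] that by (simp add: E_def algebra_simps)
  have f2c: "\<exists>c. E a (c * f1)" if "E (f2 * a) (f1 * b)" for a b
    using nzd_modD[OF f2, of a] that unfolding mem1 by (metis mult.commute)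
  have f3c: "\<exists>c d. E a (c * f2 + d * f1)" if "E (f3 * a) (b * f2 + b' * f1)" for a b b'
    using nzd_modD[OF f3, of a] that unfolding mem2 by blast
  have lc: "\<exists>c. E a (c * z)" if "E (l * a) (b * z)" for a b
    using nzd_modD[OF l, of a] that unfolding mem1 by blast
  \<comment> \<open>An element multiplied into the ideal of \<open>z\<close> by both
    \<open>f1\<close> and \<open>f2\<close> is a multiple of \<open>z\<close>: computing
    \<open>f1 * f2 * u\<close> both ways and cancelling \<open>z\<close> puts \<open>f2 * u1\<close>
    in the ideal of \<open>f1\<close>, and regularity of \<open>f1\<close>, \<open>f2\<close> does
    the rest.\<close>
  have soc: "\<exists>c. E u (c * z)" if u1: "E (f1 * u) (z * u1)" and u2: "E (f2 * u) (z * u2)" for u u1 u2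
  proof -
    have "E (z * (f2 * u1)) (z * (f1 * u2))"
      using E_trans[OF E_sym[OF E_mult[OF u1, of f2]]] E_mult[OF u2, of f1] by (simp add: ac_simps)
    then have "E (f2 * u1) (f1 * u2)" by (rule zc)
    then obtain c where "E u1 (c * f1)" using f2c by blast
    then have "E (z * u1) (f1 * (c * z))" using E_mult[of u1 "c * f1" z] by (simp add: ac_simps)
    then show ?thesis using E_trans[OF u1] f1c by blast
  qed
  obtain m1 p1 where 1: "E (f1 * G) (m1 * l + p1 * z)" using G1 unfolding mem2 by blast
  obtain m2 p2 where 2: "E (f2 * G) (m2 * l + p2 * z)" using G2 unfolding mem2 by blast
  obtain m3 p3 where 3: "E (f3 * G) (m3 * l + p3 * z)" using G3 unfolding mem2 by blast
  \<comment> \<open>Both relations compute \<open>f * f' * G\<close>, so the difference vanishes;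
    since \<open>l\<close> is regular modulo \<open>z\<close>, the cross term is itself a multiple
    of \<open>z\<close>.\<close>
  have syz: "\<exists>w. E (f * m' - f' * m) (w * z)"
    if "E (f * G) (m * l + p * z)" "E (f' * G) (m' * l + p' * z)" for f f' m m' p p'
  proof -
    have "E (f * (f' * G) - f' * (f * G)) (f * (m' * l + p' * z) - f' * (m * l + p * z))"
      by (intro E_diff E_mult that)
    moreover have "f * (f' * G) - f' * (f * G) = 0" by (simp add: algebra_simps)
    ultimately have "E (f * (m' * l + p' * z) - f' * (m * l + p * z)) 0"
      using E_sym by simp
    moreover have "f * (m' * l + p' * z) - f' * (m * l + p * z)
        = l * (f * m' - f' * m) - (f' * p - f * p') * z" by (simp add: algebra_simps)
    ultimately have "E (l * (f * m' - f' * m)) ((f' * p - f * p') * z)"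
      unfolding E_def by simp
    then show ?thesis by (rule lc)
  qed
  obtain n12 where n12: "E (f1 * m2 - f2 * m1) (n12 * z)" using syz[OF 1 2] by blast
  obtain n13 where n13: "E (f1 * m3 - f3 * m1) (n13 * z)" using syz[OF 1 3] by blast
  obtain n23 where n23: "E (f2 * m3 - f3 * m2) (n23 * z)" using syz[OF 2 3] by blast
  \<comment> \<open>Expansion of the determinant with rows \<open>f\<close>, \<open>f\<close>,
    \<open>m\<close>, which is zero. After cancelling \<open>z\<close> it puts
    \<open>f3 * n12\<close> in the ideal of \<open>f1\<close>, \<open>f2\<close>, where regularity
    of \<open>f3\<close> applies.\<close>
  have "E (f1 * (f2 * m3 - f3 * m2) - f2 * (f1 * m3 - f3 * m1) + f3 * (f1 * m2 - f2 * m1))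
          (f1 * (n23 * z) - f2 * (n13 * z) + f3 * (n12 * z))"
    by (intro E_add E_diff E_mult n12 n13 n23)
  moreover have "f1 * (f2 * m3 - f3 * m2) - f2 * (f1 * m3 - f3 * m1) + f3 * (f1 * m2 - f2 * m1) = 0"
    by (simp add: algebra_simps)
  ultimately have "E (f1 * (n23 * z) - f2 * (n13 * z) + f3 * (n12 * z)) 0"
    using E_sym by simp
  then have "E (z * (f3 * n12)) (z * (n13 * f2 + (- n23) * f1))"
    by (simp add: E_def algebra_simps)
  then have "E (f3 * n12) (n13 * f2 + (- n23) * f1)" by (rule zc)
  then obtain a1 a2 where n12': "E n12 (a1 * f2 + a2 * f1)" using f3c by blast
  have "E (f1 * m2 - f2 * m1) (z * (a1 * f2 + a2 * f1))"
    using E_trans[OF n12] E_mult[OF n12', of z] by (simp add: ac_simps)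
  then have "E (z * (a1 * f2 + a2 * f1)) (f1 * m2 - f2 * m1)" by (rule E_sym)
  then have k: "E (f2 * (m1 + z * a1)) (f1 * (m2 - z * a2))"
    by (simp add: E_def algebra_simps)
  then obtain c where c: "E (m1 + z * a1) (c * f1)" using f2c by blast
  have "E (f1 * (f2 * c)) (f1 * (m2 - z * a2))"
    using E_trans[OF E_sym[OF E_mult[OF c, of f2]] k] by (simp add: ac_simps)
  then have c2: "E (f2 * c) (m2 - z * a2)" by (rule f1c)
  \<comment> \<open>Correcting \<open>G\<close> by \<open>l * c\<close> removes the
    \<open>l\<close>-part of the first two relations, so \<open>soc\<close> applies to the
    difference.\<close>
  have "E (f1 * (G - l * c)) (z * (p1 - l * a1))"
  proof -
    have "E (f1 * G - l * (c * f1)) (m1 * l + p1 * z - l * (m1 + z * a1))"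
      by (intro E_diff 1 E_mult E_sym[OF c])
    then show ?thesis by (simp add: algebra_simps)
  qed
  moreover have "E (f2 * (G - l * c)) (z * (p2 + l * a2))"
  proof -
    have "E (f2 * G - l * (f2 * c)) (m2 * l + p2 * z - l * (m2 - z * a2))"
      by (intro E_diff 2 E_mult c2)
    then show ?thesis by (simp add: algebra_simps)
  qed
  ultimately obtain d where "E (G - l * c) (d * z)" using soc by blast
  then have "E G (c * l + d * z)" unfolding E_def by (simp add: algebra_simps)
  then show ?thesis unfolding mem2 by blast
qed

section \<open>The boundary monoid\<close>

text \<open>This is the monoid of Coquand and Lombardi's elementary characterisation of Krull dimension, with
  \<open>U\<close> in place of \<open>{1}\<close> at the bottom.\<close>
fun bmonoid :: "'a::comm_ring_1 set \<Rightarrow> 'a list \<Rightarrow> 'a set" where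
  "bmonoid U [] = U"
| "bmonoid U (f # fs) = {f ^ k * (s + a * f) | k s a. s \<in> bmonoid U fs}"

lemma bmonoid_mult:
  assumes "\<And>u v. u \<in> U \<Longrightarrow> v \<in> U \<Longrightarrow> u * v \<in> U"
  shows "a \<in> bmonoid U fs \<Longrightarrow> b \<in> bmonoid U fs \<Longrightarrow> a * b \<in> bmonoid U fs"
proof (induction fs arbitrary: a b)
  case Nil
  then show ?case using assms by simp
next
  case (Cons f fs)
  obtain k s c where a: "a = f ^ k * (s + c * f)" "s \<in> bmonoid U fs" using Cons by auto
  obtain k' s' c' where b: "b = f ^ k' * (s' + c' * f)" "s' \<in> bmonoid U fs" using Cons by auto
  have "a * b = f ^ (k + k') * (s * s' + (c * s' + c' * s + c * c' * f) * f)"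
    unfolding a b by (simp add: algebra_simps power_add)
  moreover have "s * s' \<in> bmonoid U fs" using Cons a b by blast
  ultimately show ?case by auto
qed

lemma bmonoid_one: "1 \<in> U \<Longrightarrow> 1 \<in> bmonoid U fs"
proof (induction fs)
  case (Cons f fs)
  have "1 = f ^ 0 * (1 + 0 * f)" by simp
  moreover have "1 \<in> bmonoid U fs" using Cons by simp
  ultimately show ?case unfolding bmonoid.simps by blast
qed simp

lemma bmonoid_power:
  assumes "\<And>u v. u \<in> U \<Longrightarrow> v \<in> U \<Longrightarrow> u * v \<in> U" "1 \<in> U" "a \<in> bmonoid U fs"
  shows "a ^ k \<in> bmonoid U fs"
  by (induction k) (auto intro: bmonoid_mult[OF assms(1)] bmonoid_one assms(2,3))

lemma bmonoid_prod:
  assumes "\<And>u v. u \<in> U \<Longrightarrow> v \<in> U \<Longrightarrow> u * v \<in> U" "1 \<in> U" "\<And>i. i \<in> N \<Longrightarrow> g i \<in> bmonoid U fs"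
  shows "prod g N \<in> bmonoid U fs"
  using assms(3)
  by (induction N rule: infinite_finite_induct)
    (auto intro: bmonoid_mult[OF assms(1)] bmonoid_one[OF assms(2)])

lemma nzd_mod_power: "nzd_mod J f \<Longrightarrow> f ^ k * g \<in> J \<Longrightarrow> g \<in> J"
  by (induction k) (auto dest: nzd_modD simp: mult.assoc)

text \<open>If \<open>f ^ k * (s' + a * f)\<close> lies in \<open>J\<close>, regularity cancels the
  power and leaves \<open>s'\<close> in the ideal generated by \<open>J\<close> and
  \<open>f\<close>. Repeating this along the sequence ends in \<open>U\<close>; with units for
  \<open>U\<close> this contradicts properness.\<close>

lemma bmonoid_regular_meets_units:
  assumes "is_ideal J" "s \<in> bmonoid U fs" "s \<in> J"
    and "\<And>i. i < length fs \<Longrightarrow> nzd_mod (gen_ideal (J \<union> set (take i fs))) (fs ! i)"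
  shows "gen_ideal (J \<union> set fs) \<inter> U \<noteq> {}"
  using assms
proof (induction fs arbitrary: J s)
  case Nil
  then show ?case by auto
next
  case (Cons f fs)
  obtain k s' a where s: "s = f ^ k * (s' + a * f)" "s' \<in> bmonoid U fs" using Cons by auto
  have "nzd_mod J f" using Cons.prems(4)[of 0] \<open>is_ideal J\<close> by simp
  then have "s' + a * f \<in> J" using s Cons.prems(3) nzd_mod_power by blast
  let ?J = "gen_ideal (insert f J)"
  have "s' - (- a) * f \<in> J" using \<open>s' + a * f \<in> J\<close> by simp
  then have "s' \<in> ?J" using gen_ideal_insert[OF \<open>is_ideal J\<close>] by blast
  have eq: "gen_ideal (?J \<union> G) = gen_ideal (J \<union> insert f G)" for G
    using gen_ideal_Un[of "insert f J" G] by simp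
  have "gen_ideal (?J \<union> set fs) \<inter> U \<noteq> {}"
  proof (rule Cons.IH[OF is_ideal_gen s(2) \<open>s' \<in> ?J\<close>])
    fix i assume "i < length fs"
    then show "nzd_mod (gen_ideal (?J \<union> set (take i fs))) (fs ! i)"
      using Cons.prems(4)[of "Suc i"] by (simp add: eq)
  qed
  then show ?case by (simp add: eq)
qed

text \<open>At each link the entry \<open>f\<close> lies outside the lower prime, so its power
  cancels, and inside the upper one, so \<open>s'\<close> passes to it. The chain strips the element
  down to a member of \<open>U\<close> inside the last prime.\<close>

lemma bmonoid_avoids_prime_chain:
  assumes "s \<in> bmonoid U fs" "s \<in> P 0"
    and "\<And>i. i \<le> length fs \<Longrightarrow> prime_ideal (P i)"
    and "\<And>i. i < length fs \<Longrightarrow> P i \<subseteq> P (Suc i)"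
    and "\<And>i. i < length fs \<Longrightarrow> fs ! i \<in> P (Suc i) - P i"
  shows "P (length fs) \<inter> U \<noteq> {}"
  using assms
proof (induction fs arbitrary: P s)
  case Nil
  then show ?case by auto
next
  case (Cons f fs)
  obtain k s' a where s: "s = f ^ k * (s' + a * f)" "s' \<in> bmonoid U fs" using Cons by auto
  have f: "f \<in> P 1" "f \<notin> P 0" using Cons.prems(5)[of 0] by auto
  have pr: "prime_ideal (P 0)" "prime_ideal (P 1)" using Cons.prems(3)[of 0] Cons.prems(3)[of 1] by auto
  have "f ^ k \<notin> P 0"
  proof (induction k)
    case 0
    then show ?case using pr(1) ideal_eq_UNIV by (auto simp: prime_ideal_def)
  next
    case (Suc k)
    then show ?case using pr(1) f by (auto simp: prime_ideal_def)
  qed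
  then have "s' + a * f \<in> P 0" using pr(1) s Cons.prems(2) by (auto simp: prime_ideal_def)
  then have "s' + a * f \<in> P 1" using Cons.prems(4)[of 0] by auto
  then have "s' \<in> P 1"
    using f pr(2) is_ideal_diff[of "P 1" "s' + a * f" "a * f"] is_ideal_mult_left[of "P 1" f a]
    by (auto simp: prime_ideal_def)
  then have "P (Suc (length fs)) \<inter> U \<noteq> {}"
    using Cons.prems(3,4,5)[of "Suc i" for i] by (intro Cons.IH[of s' "\<lambda>i. P (Suc i)"] s) auto
  then show ?case by simp
qed

section \<open>Substitution in the polynomial ring\<close>

primrec var_rank :: "var \<Rightarrow> nat" where
  "var_rank S = 0" | "var_rank T = 1" | "var_rank X = 2" | "var_rank Y = 3" | "var_rank Z = 4"

text \<open>The order on variables only serves to make the polynomial ring an instance of \<^class>\<open>idom\<close>.\<close>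
instantiation var :: linorder
begin

definition less_eq_var :: "var \<Rightarrow> var \<Rightarrow> bool" where
  "u \<le> v \<longleftrightarrow> var_rank u \<le> var_rank v"

definition less_var :: "var \<Rightarrow> var \<Rightarrow> bool" where
  "u < v \<longleftrightarrow> var_rank u < var_rank v"

instance
proof
  fix u v :: var
  show "u \<le> v \<Longrightarrow> v \<le> u \<Longrightarrow> u = v"
    by (cases u; cases v) (auto simp: less_eq_var_def)
qed (auto simp: less_eq_var_def less_var_def)

end

lemma UNIV_var: "UNIV = {S, T, X, Y, Z}"
  using var.exhaust by auto

definition Const :: "'k::comm_ring_1 \<Rightarrow> 'k mpoly5" where
  "Const c = Poly_Mapping.single 0 c"

lemma is_hom_Const: "is_hom Const"
  unfolding is_hom_def Const_def by (simp add: single_add mult_single)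

lemma Const_add: "Const (a + b) = Const a + Const b"
  and Const_mult: "Const (a * b) = Const a * Const b"
  and Const_minus: "Const (- a) = - Const a"
  and Const_diff: "Const (a - b) = Const a - Const b"
  and Const_1 [simp]: "Const 1 = 1"
  and Const_0 [simp]: "Const 0 = 0"
  by (simp_all add: is_hom_Const is_hom_add is_hom_mult is_hom_one is_hom_minus is_hom_diff is_hom_zero)

lemma Const_eq_iff [simp]: "Const a = Const b \<longleftrightarrow> a = b"
  unfolding Const_def by (metis lookup_single_eq)

lemma Const_eq_0_iff [simp]: "Const a = 0 \<longleftrightarrow> a = 0"
  using Const_eq_iff[of a 0] by simp

text \<open>Coefficients pass through \<open>e\<close>, so that one notion serves evaluation at
  points, endomorphisms of the ring and homomorphisms into univariate polynomials over it.\<close>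

definition psubst :: "('k::comm_ring_1 \<Rightarrow> 'r::comm_ring_1) \<Rightarrow> (var \<Rightarrow> 'r) \<Rightarrow> 'k mpoly5 \<Rightarrow> 'r" where
  "psubst e w p = (\<Sum>mo \<in> Poly_Mapping.keys p. e (Poly_Mapping.lookup p mo) *
     (\<Prod>v \<in> {S,T,X,Y,Z}. w v ^ Poly_Mapping.lookup mo v))"

lemma eval5_eq_psubst: "eval5 p pt = psubst (\<lambda>c. c) pt p"
  by (simp add: eval5_def psubst_def)

lemma psubst_superset:
  assumes "e 0 = 0" "finite N" "Poly_Mapping.keys p \<subseteq> N"
  shows "psubst e w p = (\<Sum>mo \<in> N. e (Poly_Mapping.lookup p mo) *
     (\<Prod>v \<in> {S,T,X,Y,Z}. w v ^ Poly_Mapping.lookup mo v))"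
  unfolding psubst_def using assms
  by (intro sum.mono_neutral_left) (auto simp: in_keys_iff)

lemma psubst_single:
  assumes "e 0 = 0"
  shows "psubst e w (Poly_Mapping.single mo c) = e c * (\<Prod>v \<in> {S,T,X,Y,Z}. w v ^ Poly_Mapping.lookup mo v)"
  using psubst_superset[of e "{mo}" "Poly_Mapping.single mo c" w] assms by simp

lemma psubst_add:
  assumes "is_hom e"
  shows "psubst e w (p + q) = psubst e w p + psubst e w q"
proof -
  let ?N = "Poly_Mapping.keys p \<union> Poly_Mapping.keys q"
  have "e 0 = 0" using assms by (rule is_hom_zero)
  then show ?thesis
    using keys_add[of p q]
    by (simp add: psubst_superset[of e ?N] lookup_add is_hom_add[OF assms] distrib_right sum.distrib)
qed

lemma psubst_sum:
  assumes "is_hom e"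
  shows "psubst e w (sum f N) = (\<Sum>i\<in>N. psubst e w (f i))"
proof (induction N rule: infinite_finite_induct)
  case (insert i N)
  then show ?case by (simp add: psubst_add[OF assms])
qed (simp_all add: psubst_def)

lemma mpoly_as_sum: "p = (\<Sum>mo\<in>Poly_Mapping.keys p. Poly_Mapping.single mo (Poly_Mapping.lookup p mo))"
proof (rule poly_mapping_eqI)
  fix k
  have "(\<Sum>mo\<in>Poly_Mapping.keys p. Poly_Mapping.lookup (Poly_Mapping.single mo (Poly_Mapping.lookup p mo)) k)
      = (\<Sum>mo\<in>Poly_Mapping.keys p. if mo = k then Poly_Mapping.lookup p k else 0)"
    by (intro sum.cong) (auto simp: lookup_single)
  also have "\<dots> = Poly_Mapping.lookup p k"
    by (simp add: sum.delta in_keys_iff)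
  finally show "Poly_Mapping.lookup p k =
      Poly_Mapping.lookup (\<Sum>mo\<in>Poly_Mapping.keys p. Poly_Mapping.single mo (Poly_Mapping.lookup p mo)) k"
    by (simp add: lookup_sum)
qed

lemma psubst_mult_single:
  assumes "is_hom e"
  shows "psubst e w (Poly_Mapping.single a c * Poly_Mapping.single b d)
    = psubst e w (Poly_Mapping.single a c) * psubst e w (Poly_Mapping.single b d)"
  by (simp add: mult_single psubst_single is_hom_zero[OF assms] is_hom_mult[OF assms]
      lookup_add power_add ac_simps)

lemma psubst_mult:
  assumes "is_hom e"
  shows "psubst e w (p * q) = psubst e w p * psubst e w q"
proof -
  let ?s = "\<lambda>p mo. Poly_Mapping.single mo (Poly_Mapping.lookup p mo)"
  have "p * q = (\<Sum>a\<in>Poly_Mapping.keys p. \<Sum>b\<in>Poly_Mapping.keys q. ?s p a * ?s q b)"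
    by (subst mpoly_as_sum[of p], subst mpoly_as_sum[of q]) (rule sum_product)
  then have "psubst e w (p * q)
      = (\<Sum>a\<in>Poly_Mapping.keys p. \<Sum>b\<in>Poly_Mapping.keys q. psubst e w (?s p a) * psubst e w (?s q b))"
    by (simp add: psubst_sum[OF assms] psubst_mult_single[OF assms])
  also have "\<dots> = psubst e w (\<Sum>a\<in>Poly_Mapping.keys p. ?s p a) * psubst e w (\<Sum>b\<in>Poly_Mapping.keys q. ?s q b)"
    by (simp add: psubst_sum[OF assms] sum_product)
  also have "\<dots> = psubst e w p * psubst e w q"
    by (simp add: mpoly_as_sum[symmetric])
  finally show ?thesis .
qed

lemma psubst_Const: "is_hom e \<Longrightarrow> psubst e w (Const c) = e c"
  by (simp add: Const_def psubst_single is_hom_zero)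

lemma psubst_Var:
  assumes "is_hom e"
  shows "psubst e w (Var v) = w v"
  by (cases v) (auto simp: Var_def psubst_single is_hom_zero[OF assms] is_hom_one[OF assms] lookup_single)

lemma is_hom_psubst: "is_hom e \<Longrightarrow> is_hom (psubst e w)"
  unfolding is_hom_def[of "psubst e w"]
  using psubst_Const[of e w 1] by (simp add: psubst_add psubst_mult is_hom_one)

lemma mpoly_induct [case_names Const add Var]:
  fixes p :: "'k::comm_ring_1 mpoly5"
  assumes Const: "\<And>c. P (Const c)"
    and add: "\<And>f g. P f \<Longrightarrow> P g \<Longrightarrow> P (f + g)"
    and Var: "\<And>v f. P f \<Longrightarrow> P (Var v * f)"
  shows "P p"
proof -
  have single: "P (Poly_Mapping.single mo c)" if "(\<Sum>v\<in>{S,T,X,Y,Z}. Poly_Mapping.lookup mo v) = d" for mo c d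
    using that
  proof (induction d arbitrary: mo)
    case 0
    then have "Poly_Mapping.lookup mo v = 0" for v
      by (cases v) auto
    then have "mo = 0" by (intro poly_mapping_eqI) simp
    then show ?case using Const by (simp add: Const_def)
  next
    case (Suc d)
    then obtain v where v: "Poly_Mapping.lookup mo v > 0"
      by (metis Zero_not_Suc bot_nat_0.not_eq_extremum sum.neutral)
    define mo' where "mo' = mo - Poly_Mapping.single v 1"
    have mo: "mo = Poly_Mapping.single v 1 + mo'"
      using v by (intro poly_mapping_eqI) (auto simp: mo'_def lookup_add lookup_minus lookup_single when_def)
    have "(\<Sum>u\<in>{S,T,X,Y,Z}. Poly_Mapping.lookup (Poly_Mapping.single v (1::nat)) u) = 1"
      by (cases v) (auto simp: lookup_single)
    then have "(\<Sum>v\<in>{S,T,X,Y,Z}. Poly_Mapping.lookup mo' v) = d"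
      using Suc.prems unfolding mo by (simp add: lookup_add sum.distrib)
    then have "P (Var v * Poly_Mapping.single mo' c)" by (intro Var Suc.IH)
    then show ?case by (simp add: Var_def mult_single mo)
  qed
  have "P (\<Sum>mo\<in>N. Poly_Mapping.single mo (Poly_Mapping.lookup p mo))" for N
    by (induction N rule: infinite_finite_induct) (use Const[of 0] add single in auto)
  then show ?thesis using mpoly_as_sum[of p] by metis
qed

section \<open>Algebraic dependence by counting\<close>

text \<open>Exponents form a list parallel to \<open>fs\<close>, so that recursion on the list
  matches the recursion of \<open>bmonoid\<close>.\<close>

definition power_prod :: "'a::comm_ring_1 list \<Rightarrow> nat list \<Rightarrow> 'a" where
  "power_prod fs \<alpha> = prod_list (map2 (^) fs \<alpha>)"

lemma power_prod_Nil [simp]: "power_prod [] \<alpha> = 1"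
  and power_prod_Cons [simp]: "power_prod (f # fs) (k # \<alpha>) = f ^ k * power_prod fs \<alpha>"
  by (simp_all add: power_prod_def)

lemma power_prod_add:
  "length \<alpha> = length fs \<Longrightarrow> length \<beta> = length fs \<Longrightarrow>
   power_prod fs (map2 (+) \<alpha> \<beta>) = power_prod fs \<alpha> * power_prod fs \<beta>"
proof (induction fs arbitrary: \<alpha> \<beta>)
  case (Cons f fs)
  then show ?case by (cases \<alpha>; cases \<beta>) (auto simp: power_add ac_simps)
qed simp

lemma is_hom_power_prod:
  assumes "is_hom h"
  shows "length \<alpha> = length fs \<Longrightarrow> h (power_prod fs \<alpha>) = power_prod (map h fs) \<alpha>"
proof (induction fs arbitrary: \<alpha>)
  case Nil
  then show ?case by (simp add: is_hom_one[OF assms])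
next
  case (Cons f fs)
  then show ?case
    by (cases \<alpha>) (auto simp: is_hom_mult[OF assms] is_hom_power[OF assms])
qed

abbreviation units :: "'k::field mpoly5 set" where
  "units \<equiv> Const ` (- {0})"

text \<open>With \<open>e\<close> the least exponent of the head \<open>f\<close>, the sum is
  \<open>f ^ e * (s + a * f)\<close>: the terms of exponent exactly \<open>e\<close> give
  \<open>s\<close>, again such a combination in the tail, and the remaining terms give
  \<open>a\<close>.\<close>

lemma lin_comb_in_bmonoid:
  fixes c :: "nat list \<Rightarrow> 'k::field"
  assumes "finite N" "\<And>\<alpha>. \<alpha> \<in> N \<Longrightarrow> length \<alpha> = length fs" "\<alpha>\<^sub>0 \<in> N" "c \<alpha>\<^sub>0 \<noteq> 0"
  shows "(\<Sum>\<alpha>\<in>N. Const (c \<alpha>) * power_prod fs \<alpha>) \<in> bmonoid units fs"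
  using assms
proof (induction fs arbitrary: N c \<alpha>\<^sub>0)
  case Nil
  then have "N = {[]}" by auto
  then show ?case using Nil by auto
next
  case (Cons f fs)
  \<comment> \<open>Zero coefficients are discarded first, so that the minimum \<open>e\<close> is
    attained at a term that keeps the tail combination nontrivial.\<close>
  define M where "M = {\<alpha> \<in> N. c \<alpha> \<noteq> 0}"
  define e where "e = Min (hd ` M)"
  define M1 where "M1 = {\<alpha> \<in> M. hd \<alpha> = e}"
  have M: "finite M" "M \<noteq> {}" using Cons.prems by (auto simp: M_def)
  have len: "\<alpha> = hd \<alpha> # tl \<alpha> \<and> length (tl \<alpha>) = length fs" if "\<alpha> \<in> M" for \<alpha>
    using that Cons.prems(2)[of \<alpha>] by (cases \<alpha>) (auto simp: M_def)
  have pp: "power_prod (f # fs) \<alpha> = f ^ hd \<alpha> * power_prod fs (tl \<alpha>)" if "\<alpha> \<in> M" for \<alpha>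
    using len[OF that] power_prod_Cons by metis
  have e_le: "e \<le> hd \<alpha>" if "\<alpha> \<in> M" for \<alpha> using that M by (auto simp: e_def)
  have "e \<in> hd ` M" unfolding e_def using M by (intro Min_in) auto
  then obtain \<alpha>1 where \<alpha>1: "\<alpha>1 \<in> M1" by (auto simp: M1_def)
  have inj: "inj_on tl M1"
    using len by (intro inj_onI) (auto simp: M1_def, metis)
  let ?s = "\<Sum>\<beta>\<in>tl ` M1. Const (c (e # \<beta>)) * power_prod fs \<beta>"
  have s_eq: "f ^ e * ?s = (\<Sum>\<alpha>\<in>M1. Const (c \<alpha>) * power_prod (f # fs) \<alpha>)"
  proof -
    have "?s = (\<Sum>\<alpha>\<in>M1. Const (c (e # tl \<alpha>)) * power_prod fs (tl \<alpha>))"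
      by (simp add: sum.reindex[OF inj])
    also have "\<dots> = (\<Sum>\<alpha>\<in>M1. Const (c \<alpha>) * power_prod fs (tl \<alpha>))"
      using len by (intro sum.cong refl) (force simp: M1_def)
    finally have "f ^ e * ?s = (\<Sum>\<alpha>\<in>M1. f ^ e * (Const (c \<alpha>) * power_prod fs (tl \<alpha>)))"
      by (simp only: sum_distrib_left)
    also have "\<dots> = (\<Sum>\<alpha>\<in>M1. Const (c \<alpha>) * power_prod (f # fs) \<alpha>)"
      by (intro sum.cong refl) (simp add: pp M1_def ac_simps)
    finally show ?thesis .
  qed
  have s: "?s \<in> bmonoid units fs"
  proof (rule Cons.IH)
    show "finite (tl ` M1)" using M by (simp add: M1_def)
    show "\<And>\<beta>. \<beta> \<in> tl ` M1 \<Longrightarrow> length \<beta> = length fs" using len by (auto simp: M1_def)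
    show "tl \<alpha>1 \<in> tl ` M1" using \<alpha>1 by simp
    have "e # tl \<alpha>1 = \<alpha>1" using \<alpha>1 len by (auto simp: M1_def)
    then show "c (e # tl \<alpha>1) \<noteq> 0" using \<alpha>1 by (simp add: M1_def M_def)
  qed
  let ?a = "\<Sum>\<alpha>\<in>M - M1. Const (c \<alpha>) * f ^ (hd \<alpha> - e - 1) * power_prod fs (tl \<alpha>)"
  have a_eq: "f ^ e * (?a * f) = (\<Sum>\<alpha>\<in>M - M1. Const (c \<alpha>) * power_prod (f # fs) \<alpha>)"
    unfolding sum_distrib_left sum_distrib_right
  proof (intro sum.cong refl)
    fix \<alpha> assume \<alpha>: "\<alpha> \<in> M - M1"
    then have "hd \<alpha> = e + 1 + (hd \<alpha> - e - 1)" using e_le[of \<alpha>] by (auto simp: M1_def)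
    then have "f ^ hd \<alpha> = f ^ e * f * f ^ (hd \<alpha> - e - 1)" by (metis power_add power_one_right)
    then show "f ^ e * (Const (c \<alpha>) * f ^ (hd \<alpha> - e - 1) * power_prod fs (tl \<alpha>) * f)
        = Const (c \<alpha>) * power_prod (f # fs) \<alpha>"
      using \<alpha> pp[of \<alpha>] by (simp add: ac_simps)
  qed
  have "(\<Sum>\<alpha>\<in>N. Const (c \<alpha>) * power_prod (f # fs) \<alpha>) = (\<Sum>\<alpha>\<in>M. Const (c \<alpha>) * power_prod (f # fs) \<alpha>)"
    using Cons.prems(1) by (intro sum.mono_neutral_right) (auto simp: M_def)
  also have "\<dots> = (\<Sum>\<alpha>\<in>M - M1. Const (c \<alpha>) * power_prod (f # fs) \<alpha>) + (\<Sum>\<alpha>\<in>M1. Const (c \<alpha>) * power_prod (f # fs) \<alpha>)"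
    using M by (intro sum.subset_diff) (auto simp: M1_def)
  also have "\<dots> = f ^ e * (?s + ?a * f)"
    unfolding s_eq[symmetric] a_eq[symmetric] by (simp only: distrib_left add.commute)
  finally show ?case using s by auto
qed

section \<open>Linear dependence and spans of bounded monomials\<close>

interpretation mpoly_vs: vector_space "\<lambda>(c::'k::field) (p::'k mpoly5). Const c * p"
  by unfold_locales (simp_all add: Const_add Const_mult algebra_simps)

text \<open>A family may repeat values, which dependence of its image does not detect; two equal
  values are handled by the relation with coefficients 1 and -1.\<close>

lemma mpoly_linear_dependence:
  fixes g :: "'i \<Rightarrow> 'k::field mpoly5"
  assumes "finite N" "finite W" "card W < card N" "g ` N \<subseteq> mpoly_vs.span W"
  obtains c i where "i \<in> N" "c i \<noteq> 0" "(\<Sum>i\<in>N. Const (c i) * g i) = 0"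
proof (cases "inj_on g N")
  case True
  have "mpoly_vs.dependent (g ` N)"
  proof (rule ccontr)
    assume "\<not> ?thesis"
    then have "card (g ` N) \<le> card W" using mpoly_vs.independent_span_bound assms by blast
    then show False using assms card_image[OF True] by simp
  qed
  then obtain u v where uv: "v \<in> N" "u (g v) \<noteq> 0" "(\<Sum>v\<in>g ` N. Const (u v) * v) = 0"
    using mpoly_vs.dependent_finite[of "g ` N"] assms by auto
  show ?thesis
    by (rule that[of v "\<lambda>i. u (g i)"]) (use uv in \<open>auto simp: sum.reindex[OF True]\<close>)
next
  case False
  then obtain i j where ij: "i \<in> N" "j \<in> N" "i \<noteq> j" "g i = g j" by (auto simp: inj_on_def)
  define c where "c = (\<lambda>k. if k = i then 1 else if k = j then - 1 else 0 :: 'k)"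
  have "(\<Sum>k\<in>N. Const (c k) * g k) = (\<Sum>k\<in>{i, j}. Const (c k) * g k)"
    using ij assms by (intro sum.mono_neutral_right) (auto simp: c_def)
  also have "\<dots> = 0" using ij by (simp add: c_def Const_minus)
  finally show ?thesis using that[of i c] ij by (simp add: c_def)
qed

text \<open>Each exponent is bounded separately, instead of the total degree; the exponent lists
  then form a box whose size is a plain power.\<close>

definition bounded_span :: "'k::field mpoly5 list \<Rightarrow> nat \<Rightarrow> 'k mpoly5 set" where
  "bounded_span ws d = mpoly_vs.span (power_prod ws ` {\<alpha>. set \<alpha> \<subseteq> {..d} \<and> length \<alpha> = length ws})"

lemma bounded_span_mono: "d \<le> d' \<Longrightarrow> bounded_span ws d \<subseteq> bounded_span ws d'"
  unfolding bounded_span_def by (intro mpoly_vs.span_mono image_mono) auto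

lemma bounded_span_add: "f \<in> bounded_span ws d \<Longrightarrow> g \<in> bounded_span ws d \<Longrightarrow> f + g \<in> bounded_span ws d"
  unfolding bounded_span_def by (rule mpoly_vs.span_add)

lemma bounded_span_scale: "f \<in> bounded_span ws d \<Longrightarrow> Const c * f \<in> bounded_span ws d"
  unfolding bounded_span_def by (rule mpoly_vs.span_scale)

lemma bounded_span_base:
  "set \<alpha> \<subseteq> {..d} \<Longrightarrow> length \<alpha> = length ws \<Longrightarrow> power_prod ws \<alpha> \<in> bounded_span ws d"
  unfolding bounded_span_def by (intro mpoly_vs.span_base) auto

lemma bounded_span_induct [consumes 1, case_names zero base]:
  assumes "f \<in> bounded_span ws d"
    and "P 0"
    and "\<And>c \<alpha> g. set \<alpha> \<subseteq> {..d} \<Longrightarrow> length \<alpha> = length ws \<Longrightarrow> P g \<Longrightarrow> P (Const c * power_prod ws \<alpha> + g)"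
  shows "P f"
  using assms unfolding bounded_span_def by (elim mpoly_vs.span_induct_alt) auto

lemma bounded_span_mult:
  assumes "f \<in> bounded_span ws d" "g \<in> bounded_span ws d'"
  shows "f * g \<in> bounded_span ws (d + d')"
  using assms(1)
proof (induction f rule: bounded_span_induct)
  case zero
  show ?case by (simp add: bounded_span_def mpoly_vs.span_zero)
next
  case (base c \<alpha> f)
  have "power_prod ws \<alpha> * g \<in> bounded_span ws (d + d')"
    using assms(2)
  proof (induction g rule: bounded_span_induct)
    case zero
    show ?case by (simp add: bounded_span_def mpoly_vs.span_zero)
  next
    case (base c' \<beta> g)
    have "set (map2 (+) \<alpha> \<beta>) \<subseteq> {..d + d'}"
      using \<open>set \<alpha> \<subseteq> {..d}\<close> base by (auto simp: set_zip subset_iff intro!: add_mono)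
    then have "power_prod ws (map2 (+) \<alpha> \<beta>) \<in> bounded_span ws (d + d')"
      using \<open>length \<alpha> = length ws\<close> base by (intro bounded_span_base) auto
    then have "Const c' * (power_prod ws \<alpha> * power_prod ws \<beta>) + power_prod ws \<alpha> * g \<in> bounded_span ws (d + d')"
      using \<open>length \<alpha> = length ws\<close> base
      by (intro bounded_span_add bounded_span_scale) (auto simp: power_prod_add)
    then show ?case by (simp add: algebra_simps)
  qed
  then have "Const c * (power_prod ws \<alpha> * g) + f * g \<in> bounded_span ws (d + d')"
    using base by (intro bounded_span_add bounded_span_scale)
  then show ?case by (simp add: algebra_simps)
qed

lemma bounded_span_one: "1 \<in> bounded_span ws d"
proof -
  have "power_prod ws (replicate (length ws) 0) = 1"
    by (induction ws) auto
  moreover have "set (replicate (length ws) 0) \<subseteq> {..d}" by auto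
  ultimately show ?thesis using bounded_span_base[of "replicate (length ws) 0" d ws] by simp
qed

lemma bounded_span_power: "f \<in> bounded_span ws d \<Longrightarrow> f ^ k \<in> bounded_span ws (k * d)"
  by (induction k) (auto simp: bounded_span_one intro: bounded_span_mult)

lemma bounded_span_power_prod:
  assumes "\<And>f. f \<in> set fs \<Longrightarrow> f \<in> bounded_span ws d"
  shows "set \<alpha> \<subseteq> {..N} \<Longrightarrow> length \<alpha> = length fs \<Longrightarrow> power_prod fs \<alpha> \<in> bounded_span ws (length fs * (N * d))"
  using assms
proof (induction fs arbitrary: \<alpha>)
  case Nil
  then show ?case by (simp add: bounded_span_one)
next
  case (Cons f fs)
  then obtain k \<beta> where \<alpha>: "\<alpha> = k # \<beta>" by (cases \<alpha>) auto
  have "f ^ k \<in> bounded_span ws (N * d)"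
    using Cons.prems \<alpha> bounded_span_power[of f ws d k] bounded_span_mono[of "k * d" "N * d" ws] by auto
  moreover have "power_prod fs \<beta> \<in> bounded_span ws (length fs * (N * d))"
    using Cons.prems \<alpha> by (intro Cons.IH) auto
  ultimately show ?case
    using bounded_span_mult[of "f ^ k" ws "N * d"] unfolding \<alpha> by simp
qed

lemma algebraic_dependence:
  fixes fs ws :: "'k::field mpoly5 list"
  assumes "length ws < length fs" "\<And>f. f \<in> set fs \<Longrightarrow> f \<in> bounded_span ws d"
  shows "\<exists>N c. finite N \<and> (\<forall>\<alpha>\<in>N. length \<alpha> = length fs) \<and> (\<exists>\<alpha>\<in>N. c \<alpha> \<noteq> 0) \<and>
    (\<Sum>\<alpha>\<in>N. Const (c \<alpha>) * power_prod fs \<alpha>) = 0"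
proof -
  define r where "r = length ws"
  \<comment> \<open>\<open>N\<close> is chosen so that
    \<open>(b * (N + 1)) ^ r = N * (N + 1) ^ r\<close>, which is less than the
    \<open>(N + 1) ^ (r + 1)\<close> exponent lists that \<open>r + 1\<close> elements already
    provide. \<open>D\<close> bounds the exponents needed to express their power products in
    \<open>ws\<close>.\<close>
  define b where "b = length fs * d + 1"
  define N where "N = b ^ r"
  define D where "D = length fs * (N * d)"
  define E where "E = {\<alpha>. set \<alpha> \<subseteq> {..N} \<and> length \<alpha> = length fs}"
  define W where "W = power_prod ws ` {\<alpha>. set \<alpha> \<subseteq> {..D} \<and> length \<alpha> = length ws}"
  have fin: "finite E" "finite W" unfolding E_def W_def by (auto simp: finite_lists_length_eq)
  have "card W \<le> (D + 1) ^ r"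
    unfolding W_def r_def using card_image_le[of "{\<alpha>. set \<alpha> \<subseteq> {..D} \<and> length \<alpha> = length ws}" "power_prod ws"]
    by (simp add: card_lists_length_eq finite_lists_length_eq)
  also have "\<dots> \<le> (b * (N + 1)) ^ r"
    by (intro power_mono) (auto simp: D_def b_def algebra_simps)
  also have "\<dots> = N * (N + 1) ^ r" by (simp only: power_mult_distrib N_def)
  also have "\<dots> < (N + 1) * (N + 1) ^ r" by simp
  also have "\<dots> = (N + 1) ^ Suc r" by simp
  also have "\<dots> \<le> (N + 1) ^ length fs" using assms(1) by (intro power_increasing) (auto simp: r_def)
  also have "\<dots> = card E" unfolding E_def by (simp add: card_lists_length_eq)
  finally have "card W < card E" .
  moreover have "power_prod fs ` E \<subseteq> mpoly_vs.span W"
  proof (rule image_subsetI)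
    fix \<alpha> assume "\<alpha> \<in> E"
    then have "power_prod fs \<alpha> \<in> bounded_span ws D"
      unfolding D_def E_def by (intro bounded_span_power_prod assms(2)) auto
    then show "power_prod fs \<alpha> \<in> mpoly_vs.span W" by (simp only: bounded_span_def W_def)
  qed
  ultimately obtain c \<alpha> where "\<alpha> \<in> E" "c \<alpha> \<noteq> 0" "(\<Sum>\<alpha>\<in>E. Const (c \<alpha>) * power_prod fs \<alpha>) = 0"
    by (rule mpoly_linear_dependence[OF fin])
  moreover have "\<forall>\<alpha>\<in>E. length \<alpha> = length fs" by (simp add: E_def)
  ultimately show ?thesis using fin(1) by blast
qed

text \<open>The images under \<open>h\<close> are polynomials in the fewer elements
  \<open>ws\<close>, so they satisfy a relation. The same combination of the original
  \<open>fs\<close> is the required element, since \<open>h\<close> fixes constants.\<close>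

lemma bmonoid_meets_kernel:
  fixes h :: "'k::field mpoly5 \<Rightarrow> 'k mpoly5"
  assumes h: "is_hom h" and hc: "\<And>c. h (Const c) = Const c"
    and hv: "\<And>v. h (Var v) \<in> bounded_span ws 1"
    and len: "length ws < length fs"
  obtains s where "s \<in> bmonoid units fs" "h s = 0"
proof -
  have ex: "\<exists>d. h f \<in> bounded_span ws d" for f
  proof (induction f rule: mpoly_induct)
    case (Const c)
    show ?case using bounded_span_scale[OF bounded_span_one, of c ws] hc by auto
  next
    case (add f g)
    then obtain d d' where "h f \<in> bounded_span ws d" "h g \<in> bounded_span ws d'" by auto
    then have "h f + h g \<in> bounded_span ws (max d d')"
      using bounded_span_mono[of d "max d d'" ws] bounded_span_mono[of d' "max d d'" ws]
      by (intro bounded_span_add) auto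
    then show ?case by (auto simp: is_hom_add[OF h])
  next
    case (Var v f)
    then show ?case using bounded_span_mult[OF hv] by (auto simp: is_hom_mult[OF h])
  qed
  then obtain dd where dd: "h f \<in> bounded_span ws (dd f)" for f by metis
  define d where "d = Max (dd ` set fs)"
  have "g \<in> bounded_span ws d" if "g \<in> set (map h fs)" for g
  proof -
    from that obtain f where f: "f \<in> set fs" "g = h f" by auto
    then have "dd f \<le> d" by (simp add: d_def)
    then show ?thesis using dd[of f] f bounded_span_mono by blast
  qed
  moreover have "length ws < length (map h fs)" using len by simp
  ultimately have "\<exists>N c. finite N \<and> (\<forall>\<alpha>\<in>N. length \<alpha> = length (map h fs)) \<and> (\<exists>\<alpha>\<in>N. c \<alpha> \<noteq> 0) \<and>
      (\<Sum>\<alpha>\<in>N. Const (c \<alpha>) * power_prod (map h fs) \<alpha>) = 0"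
    by (intro algebraic_dependence)
  then obtain N c \<alpha> where N: "finite N" "\<forall>\<alpha>\<in>N. length \<alpha> = length fs"
    "\<alpha> \<in> N" "c \<alpha> \<noteq> 0" "(\<Sum>\<alpha>\<in>N. Const (c \<alpha>) * power_prod (map h fs) \<alpha>) = 0"
    by auto
  let ?s = "\<Sum>\<alpha>\<in>N. Const (c \<alpha>) * power_prod fs \<alpha>"
  have "h (sum g M) = (\<Sum>i\<in>M. h (g i))" for g :: "nat list \<Rightarrow> _" and M
    by (induction M rule: infinite_finite_induct) (simp_all add: is_hom_add[OF h] is_hom_zero[OF h])
  then have "h ?s = (\<Sum>\<alpha>\<in>N. Const (c \<alpha>) * power_prod (map h fs) \<alpha>)"
    using N(2) by (simp add: is_hom_mult[OF h] hc is_hom_power_prod[OF h])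
  then have "h ?s = 0" using N(5) by simp
  have "?s \<in> bmonoid units fs"
    by (rule lin_comb_in_bmonoid[of N fs \<alpha> c]) (use N in auto)
  then show ?thesis using \<open>h ?s = 0\<close> by (rule that)
qed

section \<open>Linear coordinates adapted to the configuration\<close>

text \<open>The common point of the lines \<open>V(B\<^sub>i)\<close> has \<open>(v0 : v1 : v2) = (1 : q1 : q2)\<close>; the parameters \<open>la\<close> and
  \<open>mu\<close> are generic, so that no \<open>A\<^sub>i\<close> is a multiple of \<open>l\<close> and no \<open>B\<^sub>i\<close> a multiple of \<open>x\<close>.\<close>
locale frame =
  fixes v0 v1 v2 :: var and q1 q2 la mu :: "'k::field"
  assumes UNIV_vars: "UNIV = {S, T, v0, v1, v2}"
    and distinct_vars: "distinct [S, T, v0, v1, v2]"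
begin

definition t :: "'k mpoly5" where "t = Var T"
definition l :: "'k mpoly5" where "l = Var S + Const la * Var T"
definition z :: "'k mpoly5" where "z = Var v0"
definition y :: "'k mpoly5" where "y = Var v2 - Const q2 * z"
definition x :: "'k mpoly5" where "x = (Var v1 - Const q1 * z) + Const mu * y"

text \<open>The values at the variables invert the linear change of coordinates, so the five
  arguments become the images of \<open>l\<close>, \<open>t\<close>, \<open>x\<close>,
  \<open>y\<close>, \<open>z\<close>; the last branch is the one for \<open>v1\<close>.\<close>

definition fsub :: "('k \<Rightarrow> 'r::comm_ring_1) \<Rightarrow> 'r \<Rightarrow> 'r \<Rightarrow> 'r \<Rightarrow> 'r \<Rightarrow> 'r \<Rightarrow> 'k mpoly5 \<Rightarrow> 'r" where
  "fsub e vl vt vx vy vz = psubst e (\<lambda>v. if v = T then vt else if v = S then vl - e la * vt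
     else if v = v0 then vz else if v = v2 then vy + e q2 * vz else (vx - e mu * vy) + e q1 * vz)"

lemma is_hom_fsub: "is_hom e \<Longrightarrow> is_hom (fsub e vl vt vx vy vz)"
  unfolding fsub_def by (rule is_hom_psubst)

lemma fsub_Const: "is_hom e \<Longrightarrow> fsub e vl vt vx vy vz (Const c) = e c"
  unfolding fsub_def by (rule psubst_Const)

lemma fsub_coords:
  assumes "is_hom e"
  shows "fsub e vl vt vx vy vz l = vl" "fsub e vl vt vx vy vz t = vt" "fsub e vl vt vx vy vz x = vx"
    "fsub e vl vt vx vy vz y = vy" "fsub e vl vt vx vy vz z = vz"
proof -
  have ne: "v0 \<noteq> S" "v0 \<noteq> T" "v1 \<noteq> S" "v1 \<noteq> T" "v2 \<noteq> S" "v2 \<noteq> T" "v1 \<noteq> v0" "v2 \<noteq> v0" "v1 \<noteq> v2"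
    using distinct_vars by auto
  show "fsub e vl vt vx vy vz l = vl" "fsub e vl vt vx vy vz t = vt" "fsub e vl vt vx vy vz x = vx"
    "fsub e vl vt vx vy vz y = vy" "fsub e vl vt vx vy vz z = vz"
    by (simp_all add: ne l_def t_def x_def y_def z_def fsub_def is_hom_add[OF is_hom_psubst[OF assms]]
      is_hom_mult[OF is_hom_psubst[OF assms]] is_hom_diff[OF is_hom_psubst[OF assms]]
      psubst_Const[OF assms] psubst_Var[OF assms])
qed

lemma Var_eqs: "Var S = l - Const la * t" "Var T = t" "Var v0 = z" "Var v2 = y + Const q2 * z"
  "Var v1 = (x - Const mu * y) + Const q1 * z"
  by (simp_all add: l_def t_def x_def y_def z_def)

lemma var_cases: "v = S \<or> v = T \<or> v = v0 \<or> v = v1 \<or> v = v2"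
  using UNIV_vars by auto

lemma frame_induct [case_names Const add coord]:
  fixes p :: "'k mpoly5"
  assumes Const: "\<And>c. P (Const c)"
    and add: "\<And>f g. P f \<Longrightarrow> P g \<Longrightarrow> P (f + g)"
    and coord: "\<And>u f. u \<in> {l, t, x, y, z} \<Longrightarrow> P f \<Longrightarrow> P (u * f)"
  shows "P p"
proof -
  \<comment> \<open>A variable is a combination of coordinates with scalar coefficients, and
    \<open>P\<close> is not assumed stable under scalars; hence the scalar in the induction
    statement.\<close>
  have "\<forall>c. P (Const c * p)"
  proof (induction p rule: mpoly_induct)
    case (Const d)
    show ?case using assms(1) by (simp add: Const_mult[symmetric])
  next
    case (add f g)
    then show ?case using assms(2) by (simp add: distrib_left)
  next
    case (Var v f)
    have "P (u * (Const c * f))" if "u \<in> {l, t, x, y, z}" for u c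
      using Var coord[OF that] by blast
    then have u: "P (Const c * (u * f))" if "u \<in> {l, t, x, y, z}" for u c
      using that unfolding mult.left_commute[of "Const c" u f] by blast
    have cu: "P (Const c * (Const d * u * f))" if "u \<in> {l, t, x, y, z}" for u c d
      using u[OF that, of "c * d"] by (simp add: Const_mult ac_simps)
    show ?case
    proof
      fix c
      have "Const c * (Var S * f) = Const c * (l * f) + Const c * (Const (- la) * t * f)"
        "Const c * (Var v2 * f) = Const c * (y * f) + Const c * (Const q2 * z * f)"
        "Const c * (Var v1 * f)
          = (Const c * (x * f) + Const c * (Const (- mu) * y * f)) + Const c * (Const q1 * z * f)"
        by (simp_all add: Var_eqs Const_minus algebra_simps)
      then have "P (Const c * (Var S * f))" "P (Const c * (Var v2 * f))" "P (Const c * (Var v1 * f))"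
        by (simp_all only:) (intro assms(2) u cu; simp)+
      moreover have "P (Const c * (Var T * f))" "P (Const c * (Var v0 * f))"
        using u[of t c] u[of z c] by (simp_all add: Var_eqs)
      ultimately show "P (Const c * (Var v * f))" using var_cases[of v] by blast
    qed
  qed
  then have "P (Const 1 * p)" by blast
  then show ?thesis by simp
qed

lemma is_hom_frame_ext:
  assumes "is_hom g" "is_hom h" "\<And>c. g (Const c) = h (Const c)"
    "g l = h l" "g t = h t" "g x = h x" "g y = h y" "g z = h z"
  shows "g p = h p"
  by (induction p rule: frame_induct) (use assms in \<open>auto simp: is_hom_add is_hom_mult\<close>)

text \<open>Since \<open>u * f - h u * h f = u * (f - h f) + (u - h u) * h f\<close>, a check on the
  coordinates suffices. In particular an element with \<open>h p = 0\<close> lies in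
  \<open>J\<close>, which identifies ideals of linear subspaces with kernels of
  substitutions.\<close>

lemma congruent_endo:
  assumes h: "is_hom h" and J: "is_ideal J" and hc: "\<And>c. h (Const c) = Const c"
    and coord: "\<And>u. u \<in> {l, t, x, y, z} \<Longrightarrow> u - h u \<in> J"
  shows "p - h p \<in> J"
proof (induction p rule: frame_induct)
  case (Const c)
  then show ?case using hc is_ideal_zero[OF J] by simp
next
  case (add f g)
  then have "(f - h f) + (g - h g) \<in> J" by (intro is_ideal_add[OF J])
  then show ?case by (simp add: is_hom_add[OF h] algebra_simps)
next
  case (coord u f)
  have "u * (f - h f) + (u - h u) * h f \<in> J"
    by (rule is_ideal_add[OF J is_ideal_mult_left[OF J coord(2)] is_ideal_mult_right[OF J assms(4)[OF coord(1)]]])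
  then show ?case by (simp add: is_hom_mult[OF h] algebra_simps)
qed

abbreviation endo :: "'k mpoly5 \<Rightarrow> 'k mpoly5 \<Rightarrow> 'k mpoly5 \<Rightarrow> 'k mpoly5 \<Rightarrow> 'k mpoly5 \<Rightarrow> 'k mpoly5 \<Rightarrow> 'k mpoly5"
  where "endo \<equiv> fsub Const"

lemmas endo_coords = fsub_coords[OF is_hom_Const] fsub_Const[OF is_hom_Const]
lemmas is_hom_endo = is_hom_fsub[OF is_hom_Const]
lemmas endo_simps = endo_coords is_hom_add[OF is_hom_endo] is_hom_mult[OF is_hom_endo]
  is_hom_diff[OF is_hom_endo] is_hom_minus[OF is_hom_endo] is_hom_zero[OF is_hom_endo]
  is_hom_one[OF is_hom_endo] is_hom_prod[OF is_hom_endo] is_hom_power[OF is_hom_endo]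

lemma endo_comp:
  "endo vl vt vx vy vz (endo wl wt wx wy wz p)
    = endo (endo vl vt vx vy vz wl) (endo vl vt vx vy vz wt) (endo vl vt vx vy vz wx)
        (endo vl vt vx vy vz wy) (endo vl vt vx vy vz wz) p"
  by (rule is_hom_frame_ext[OF is_hom_comp[OF is_hom_endo is_hom_endo] is_hom_endo])
    (simp_all add: endo_coords)

lemma coords_nonzero: "l \<noteq> 0" "t \<noteq> 0" "x \<noteq> 0" "y \<noteq> 0" "z \<noteq> 0"
proof -
  have id: "is_hom (\<lambda>c. c :: 'k)" by (simp add: is_hom_def)
  show "l \<noteq> 0" "t \<noteq> 0" "x \<noteq> 0" "y \<noteq> 0" "z \<noteq> 0"
    using fsub_coords[OF id, of 1 1 1 1 1] is_hom_zero[OF is_hom_fsub[OF id, of 1 1 1 1 1]]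
    by (metis zero_neq_one)+
qed

lemma is_hom_const_poly: "is_hom (\<lambda>c. [:Const c:])"
  by (simp add: is_hom_def Const_add Const_mult)

lemma irrel_least:
  assumes J: "is_ideal J" and "{l, t, x, y, z} \<subseteq> J"
  shows "irrel \<subseteq> J"
  unfolding irrel_def
proof (intro gen_ideal_least J image_subsetI)
  fix v
  have "Var S \<in> J" "Var T \<in> J" "Var v0 \<in> J" "Var v1 \<in> J" "Var v2 \<in> J"
    unfolding Var_eqs using assms
    by (auto intro!: is_ideal_add[OF J] is_ideal_diff[OF J] is_ideal_mult_left[OF J])
  then show "Var v \<in> J" using var_cases[of v] by blast
qed

lemma Var_irrel: "Var v \<in> irrel"
  unfolding irrel_def by (rule gen_ideal_base) simp

lemma is_ideal_irrel: "is_ideal irrel"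
  by (simp add: irrel_def)

lemma coords_irrel: "l \<in> irrel" "t \<in> irrel" "x \<in> irrel" "y \<in> irrel" "z \<in> irrel"
  unfolding l_def t_def x_def y_def z_def
  by (intro is_ideal_add[OF is_ideal_irrel] is_ideal_diff[OF is_ideal_irrel]
      is_ideal_mult_left[OF is_ideal_irrel] Var_irrel)+

lemma irrel_proper: "(1 :: 'k mpoly5) \<notin> irrel"
proof -
  let ?h = "endo 0 0 0 0 0"
  have "irrel \<subseteq> {f. ?h f = 0}"
    by (rule irrel_least[OF is_ideal_kernel[OF is_hom_endo]]) (simp add: endo_coords)
  then have "(1 :: 'k mpoly5) \<in> irrel \<Longrightarrow> ?h 1 = 0" by blast
  then show ?thesis by (auto simp: endo_simps)
qed

lemma endo_Var_bounded_span:
  assumes "{vl, vt, vx, vy, vz} \<subseteq> bounded_span ws 1"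
  shows "endo vl vt vx vy vz (Var v) \<in> bounded_span ws 1"
proof -
  have diff: "f - Const c * g \<in> bounded_span ws 1" if "f \<in> bounded_span ws 1" "g \<in> bounded_span ws 1" for f g c
    using bounded_span_add[OF that(1) bounded_span_scale[OF that(2), of "- c"]] by (simp add: Const_minus)
  have "endo vl vt vx vy vz (Var S) \<in> bounded_span ws 1" "endo vl vt vx vy vz (Var T) \<in> bounded_span ws 1"
    "endo vl vt vx vy vz (Var v0) \<in> bounded_span ws 1" "endo vl vt vx vy vz (Var v1) \<in> bounded_span ws 1"
    "endo vl vt vx vy vz (Var v2) \<in> bounded_span ws 1"
    using assms unfolding Var_eqs endo_simps
    by (auto intro!: diff bounded_span_add bounded_span_scale simp del: One_nat_def)
  then show ?thesis using var_cases[of v] by blast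
qed

section \<open>Powers of the ideal of the vertical line\<close>

definition Q :: "'k mpoly5 set" where "Q = gen_ideal {x, y}"

text \<open>The indeterminate records the degree in \<open>x\<close> and \<open>y\<close>:
  coefficient \<open>e\<close> is the part of the polynomial of degree \<open>e\<close> in these two
  coordinates.\<close>

definition rees :: "'k mpoly5 \<Rightarrow> 'k mpoly5 poly" where
  "rees = fsub (\<lambda>c. [:Const c:]) [:l:] [:t:] [:0, x:] [:0, y:] [:z:]"

lemma is_hom_rees: "is_hom rees"
  unfolding rees_def by (rule is_hom_fsub[OF is_hom_const_poly])

lemma rees_coords: "rees l = [:l:]" "rees t = [:t:]" "rees x = [:0, x:]" "rees y = [:0, y:]" "rees z = [:z:]"
  "rees (Const c) = [:Const c:]"
  unfolding rees_def by (simp_all add: fsub_coords[OF is_hom_const_poly] fsub_Const[OF is_hom_const_poly])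

lemmas rees_simps = rees_coords is_hom_add[OF is_hom_rees] is_hom_mult[OF is_hom_rees]
  is_hom_diff[OF is_hom_rees]  is_hom_power[OF is_hom_rees]

lemma xy_Q: "x \<in> Q" "y \<in> Q"
  by (simp_all add: Q_def gen_ideal_base)

lemma is_ideal_Q: "is_ideal Q"
  by (simp add: Q_def)

text \<open>Truncation below degree \<open>m\<close> recovers a polynomial modulo
  \<open>ideal_pow Q m\<close>. Multiplication by \<open>x\<close> or \<open>y\<close> shifts
  degrees by one, which is why \<open>m\<close> varies in the induction.\<close>

lemma rees_expansion: "f - (\<Sum>e<m. coeff (rees f) e) \<in> ideal_pow Q m"
proof (induction f arbitrary: m rule: frame_induct)
  case (Const c)
  show ?case
  proof (cases m)
    case (Suc m')
    have "(\<Sum>e<m. coeff (rees (Const c)) e) = Const c"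
      unfolding Suc by (subst sum.lessThan_Suc_shift) (simp add: rees_coords)
    then show ?thesis using is_ideal_zero[OF is_ideal_pow] by simp
  qed simp
next
  case (add f g)
  have "(f - (\<Sum>e<m. coeff (rees f) e)) + (g - (\<Sum>e<m. coeff (rees g) e)) \<in> ideal_pow Q m"
    by (intro is_ideal_add is_ideal_pow add)
  then show ?case by (simp add: rees_simps sum.distrib algebra_simps)
next
  case (coord u f)
  show ?case
  proof (cases "u \<in> {x, y}")
    case True
    then have u: "rees u = [:0, u:]" "u \<in> Q" using rees_coords xy_Q by auto
    show ?thesis
    proof (cases m)
      case (Suc m')
      have "(\<Sum>e<m. coeff (rees (u * f)) e) = u * (\<Sum>e<m'. coeff (rees f) e)"
        unfolding Suc by (subst sum.lessThan_Suc_shift) (simp add: is_hom_mult[OF is_hom_rees] u sum_distrib_left)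
      moreover have "u * (f - (\<Sum>e<m'. coeff (rees f) e)) \<in> ideal_pow Q m"
        unfolding Suc by (intro ideal_pow_Suc_mem u coord)
      ultimately show ?thesis by (simp add: algebra_simps)
    qed simp
  next
    case False
    then have u: "rees u = [:u:]" using coord(1) rees_coords by auto
    have "(\<Sum>e<m. coeff (rees (u * f)) e) = u * (\<Sum>e<m. coeff (rees f) e)"
      by (simp add: is_hom_mult[OF is_hom_rees] u sum_distrib_left)
    moreover have "u * (f - (\<Sum>e<m. coeff (rees f) e)) \<in> ideal_pow Q m"
      by (intro is_ideal_mult_left is_ideal_pow coord)
    ultimately show ?thesis by (simp add: algebra_simps)
  qed
qed

lemma is_ideal_coeffs_vanish: "is_ideal {p :: 'k mpoly5 poly. \<forall>e<m. coeff p e = 0}"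
  unfolding is_ideal_def by (auto simp: coeff_mult)

lemma Q_pow_coeffs_vanish: "ideal_pow Q m \<subseteq> {f. \<forall>e<m. coeff (rees f) e = 0}"
proof (induction m)
  case (Suc m)
  have ideal: "is_ideal {f. \<forall>e<m. coeff (rees f) e = 0}" for m
    using is_ideal_vimage[OF is_hom_rees is_ideal_coeffs_vanish] by (simp add: vimage_def)
  have "Q \<subseteq> {f. \<forall>e<1. coeff (rees f) e = 0}"
    unfolding Q_def by (intro gen_ideal_least ideal) (simp add: rees_coords)
  then have Q0: "coeff (rees a) 0 = 0" if "a \<in> Q" for a using that by auto
  show ?case
  proof (rule ideal_pow_Suc_least[OF ideal])
    fix a b assume a: "a \<in> Q" and "b \<in> ideal_pow Q m"
    then have b: "\<forall>e<m. coeff (rees b) e = 0" using Suc by auto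
    obtain p where p: "rees a = pCons 0 p" using Q0[OF a] by (metis coeff_pCons_0 pCons_cases)
    have "coeff (rees (a * b)) e = 0" if "e < Suc m" for e
    proof (cases e)
      case (Suc e')
      then show ?thesis using b that
        by (auto simp: is_hom_mult[OF is_hom_rees] p coeff_mult intro!: sum.neutral)
    qed (simp add: is_hom_mult[OF is_hom_rees] p)
    then show "a * b \<in> {f. \<forall>e<Suc m. coeff (rees f) e = 0}" by blast
  qed
qed simp

lemma mem_Q_pow: "f \<in> ideal_pow Q m \<longleftrightarrow> (\<forall>e<m. coeff (rees f) e = 0)"
proof
  assume "\<forall>e<m. coeff (rees f) e = 0"
  then have "(\<Sum>e<m. coeff (rees f) e) = 0" by simp
  then show "f \<in> ideal_pow Q m" using rees_expansion[of f m] by simp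
qed (use Q_pow_coeffs_vanish in blast)

text \<open>In a domain the lowest component of a product is the product of the lowest components.
  As the component of \<open>g\<close> in degree 0 is nonzero, the components of the other factor
  below degree \<open>m\<close> vanish one after another.\<close>

lemma nzd_mod_Q_pow:
  assumes "coeff (rees g) 0 \<noteq> 0"
  shows "nzd_mod (ideal_pow Q m) g"
  unfolding nzd_mod_def
proof (intro allI impI)
  fix f assume f: "g * f \<in> ideal_pow Q m"
  have "e < m \<Longrightarrow> coeff (rees f) e = 0" for e
  proof (induction e rule: less_induct)
    case (less e)
    have "coeff (rees g * rees f) e = 0"
      using f less.prems unfolding mem_Q_pow is_hom_mult[OF is_hom_rees] by blast
    moreover have "coeff (rees g * rees f) e = (\<Sum>i\<le>e. coeff (rees g) i * coeff (rees f) (e - i))"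
      by (rule coeff_mult)
    moreover have "\<dots> = (\<Sum>i\<in>{0}. coeff (rees g) i * coeff (rees f) (e - i))"
      using less by (intro sum.mono_neutral_right) auto
    ultimately show ?case using assms by simp
  qed
  then show "f \<in> ideal_pow Q m" by (simp add: mem_Q_pow)
qed

lemma endo_Q_pow:
  assumes "vx \<in> Q" "vy \<in> Q" "f \<in> ideal_pow Q m"
  shows "endo vl vt vx vy vz f \<in> ideal_pow Q m"
proof (rule is_hom_ideal_pow[OF is_hom_endo _ assms(3)])
  show "endo vl vt vx vy vz ` Q \<subseteq> Q"
  proof (rule image_subsetI)
    fix f assume "f \<in> Q"
    then show "endo vl vt vx vy vz f \<in> Q"
      using assms(1,2) unfolding Q_def
      by (intro is_hom_gen_ideal[OF is_hom_endo, of _ _ _ _ _ "{x, y}"]) (auto simp: endo_coords)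
  qed
qed

end

section \<open>The configuration in adapted coordinates\<close>

locale configuration = frame v0 v1 v2 q1 q2 la mu
  for v0 v1 v2 and q1 q2 la mu :: "'k::field" +
  fixes a b :: "nat \<Rightarrow> 'k" and n :: nat
  assumes n_ge: "n \<ge> 2" and inj_b: "inj_on b {1..n}" and a_neq: "a (n - 1) \<noteq> a n"
begin

abbreviation vform :: "nat \<Rightarrow> 'k mpoly5" where "vform i \<equiv> y - Const (b i) * x"

abbreviation hform :: "nat \<Rightarrow> 'k mpoly5" where "hform i \<equiv> t - Const (a i) * l"

definition PP :: "nat \<Rightarrow> 'k mpoly5 set" where "PP i = gen_ideal {hform i, vform i}"

definition II :: "nat \<Rightarrow> 'k mpoly5 set" where
  "II m = (\<Inter>i\<in>{1..n}. PP i) \<inter> ideal_pow Q m"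

text \<open>Restriction to the horizontal line with index \<open>i\<close>, where \<open>l\<close>,
  \<open>x\<close>, \<open>z\<close> remain as coordinates.\<close>

abbreviation restr :: "nat \<Rightarrow> 'k mpoly5 \<Rightarrow> 'k mpoly5" where
  "restr i \<equiv> endo l (Const (a i) * l) x (Const (b i) * x) z"

lemma is_ideal_PP: "is_ideal (PP i)"
  by (simp add: PP_def)

lemma is_ideal_II: "is_ideal (II m)"
  unfolding II_def by (intro is_ideal_Int is_ideal_INT is_ideal_PP is_ideal_pow)

lemma forms_PP: "hform i \<in> PP i" "vform i \<in> PP i"
  by (simp_all add: PP_def gen_ideal_base)

lemma mem_PP: "f \<in> PP i \<longleftrightarrow> restr i f = 0"
proof
  assume f: "f \<in> PP i"
  have "PP i \<subseteq> {f. restr i f = 0}"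
    unfolding PP_def by (intro gen_ideal_least is_ideal_kernel is_hom_endo) (simp add: endo_simps)
  then show "restr i f = 0" using f by blast
next
  assume "restr i f = 0"
  moreover have "f - restr i f \<in> PP i"
  proof (rule congruent_endo[OF is_hom_endo is_ideal_PP])
    show "u - restr i u \<in> PP i" if "u \<in> {l, t, x, y, z}" for u
      using that forms_PP is_ideal_zero[OF is_ideal_PP] by (auto simp: endo_coords)
  qed (simp add: endo_coords)
  ultimately show "f \<in> PP i" by simp
qed

lemma mem_II: "f \<in> II m \<longleftrightarrow> (\<forall>i\<in>{1..n}. restr i f = 0) \<and> f \<in> ideal_pow Q m"
  by (auto simp: II_def mem_PP)

text \<open>The hypotheses say that \<open>g\<close> avoids \<open>Q\<close> and every prime
  \<open>PP i\<close>; such an element cancels in each component of the intersection.\<close>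

lemma nzd_mod_II:
  assumes "coeff (rees g) 0 \<noteq> 0" "\<And>i. i \<in> {1..n} \<Longrightarrow> restr i g \<noteq> 0"
  shows "nzd_mod (II m) g"
  unfolding nzd_mod_def mem_II
  using assms(2) nzd_modD[OF nzd_mod_Q_pow[OF assms(1)]] by (auto simp: is_hom_mult[OF is_hom_endo])

lemma nzd_z: "nzd_mod (II m) z" and nzd_l: "nzd_mod (II m) l"
  by (rule nzd_mod_II; simp add: rees_coords endo_coords coords_nonzero)+

section \<open>Reduction modulo \<open>z\<close>\<close>

abbreviation cut_z :: "'k mpoly5 \<Rightarrow> 'k mpoly5" where "cut_z \<equiv> endo l t x y 0"

text \<open>The forms defining the components do not involve \<open>z\<close>, so setting
  \<open>z\<close> to zero commutes with every restriction and preserves the powers of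
  \<open>Q\<close>.\<close>

lemma cut_z_II:
  assumes "f \<in> II m"
  shows "cut_z f \<in> II m"
  unfolding mem_II
proof (intro conjI ballI)
  fix i assume "i \<in> {1..n}"
  then have "cut_z (restr i f) = 0" using assms by (simp add: mem_II endo_simps)
  then show "restr i (cut_z f) = 0" by (simp add: endo_comp endo_simps)
qed (use assms endo_Q_pow[OF xy_Q] in \<open>auto simp: mem_II\<close>)

lemma mem_insert_z_II: "f \<in> gen_ideal (insert z (II m)) \<longleftrightarrow> cut_z f \<in> II m"
proof
  assume f: "f \<in> gen_ideal (insert z (II m))"
  have "gen_ideal (insert z (II m)) \<subseteq> cut_z -` II m"
    using cut_z_II is_ideal_zero[OF is_ideal_II]
    by (intro gen_ideal_least is_ideal_vimage is_hom_endo is_ideal_II) (auto simp: endo_coords)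
  then show "cut_z f \<in> II m" using f by auto
next
  let ?J = "gen_ideal (insert z (II m))"
  assume "cut_z f \<in> II m"
  then have "cut_z f \<in> ?J" by (simp add: gen_ideal_base)
  moreover have "f - cut_z f \<in> ?J"
  proof (rule congruent_endo[OF is_hom_endo is_ideal_gen])
    show "u - cut_z u \<in> ?J" if "u \<in> {l, t, x, y, z}" for u
      using that is_ideal_zero[OF is_ideal_gen] by (auto simp: endo_coords intro: gen_ideal_base)
  qed (simp add: endo_coords)
  ultimately show "f \<in> ?J" using is_ideal_diff_cancel[OF is_ideal_gen] by blast
qed

lemma nzd_l_insert_z: "nzd_mod (gen_ideal (insert z (II m))) l"
  unfolding nzd_mod_def mem_insert_z_II
  by (auto simp: endo_simps intro: nzd_modD[OF nzd_l])

lemma II_subset_irrel: "II m \<subseteq> irrel"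
proof -
  have "PP 1 \<subseteq> irrel"
    unfolding PP_def using coords_irrel is_ideal_irrel
    by (intro gen_ideal_least) (auto intro!: is_ideal_diff is_ideal_mult_left)
  moreover have "II m \<subseteq> PP 1" using n_ge by (auto simp: II_def)
  ultimately show ?thesis by blast
qed

subsection \<open>Dimension and depth are at most three\<close>

text \<open>Each component has three parameters: \<open>l\<close>, \<open>x\<close>,
  \<open>z\<close> on a horizontal line and \<open>l\<close>, \<open>t\<close>, \<open>z\<close>
  modulo \<open>Q\<close>. Four elements are therefore dependent on each of them, and the monoid
  elements so obtained multiply to one in the intersection.\<close>

lemma bmonoid_meets_II:
  fixes fs :: "'k mpoly5 list"
  assumes "length fs = 4"
  shows "\<exists>s. s \<in> bmonoid units fs \<and> s \<in> II m"
proof -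
  have base: "{f, g, h, 0} \<subseteq> bounded_span [f, g, h] 1" for f g h :: "'k mpoly5"
    using bounded_span_base[of "[1, 0, 0]" 1 "[f, g, h]"] bounded_span_base[of "[0, 1, 0]" 1 "[f, g, h]"]
      bounded_span_base[of "[0, 0, 1]" 1 "[f, g, h]"] bounded_span_scale[OF bounded_span_one, of 0 "[f, g, h]" 1]
    by (simp add: power_prod_def)
  have "\<exists>s. s \<in> bmonoid units fs \<and> restr i s = 0" for i
  proof -
    have "endo l (Const (a i) * l) x (Const (b i) * x) z (Var v) \<in> bounded_span [l, x, z] 1" for v
      using base[of l x z] by (intro endo_Var_bounded_span) (auto intro: bounded_span_scale simp del: One_nat_def)
    then obtain s where "s \<in> bmonoid units fs" "restr i s = 0"
      by (rule bmonoid_meets_kernel[OF is_hom_endo fsub_Const[OF is_hom_Const], of _ _ _ _ _ "[l, x, z]" fs])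
        (simp add: assms)
    then show ?thesis by blast
  qed
  then obtain s where s: "\<And>i. s i \<in> bmonoid units fs" "\<And>i. restr i (s i) = 0" by metis
  have "endo l t 0 0 z (Var v) \<in> bounded_span [l, t, z] 1" for v
    using base[of l t z] by (intro endo_Var_bounded_span) auto
  then obtain s' where s': "s' \<in> bmonoid units fs" "endo l t 0 0 z s' = 0"
    by (rule bmonoid_meets_kernel[OF is_hom_endo fsub_Const[OF is_hom_Const], of _ _ _ _ _ "[l, t, z]" fs])
      (simp add: assms)
  have "s' - endo l t 0 0 z s' \<in> Q"
  proof (rule congruent_endo[OF is_hom_endo is_ideal_Q])
    show "u - endo l t 0 0 z u \<in> Q" if "u \<in> {l, t, x, y, z}" for u
      using that is_ideal_zero[OF is_ideal_Q] xy_Q by (auto simp: endo_coords)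
  qed (simp add: endo_coords)
  then have s'Q: "s' \<in> Q" using s' by simp
  \<comment> \<open>The last dependence yields an element of \<open>Q\<close>; its
    \<open>m\<close>-th power reaches the fat component.\<close>
  let ?p = "(\<Prod>i\<in>{1..n}. s i) * s' ^ m"
  have units: "u * v \<in> (units :: 'k mpoly5 set)" if "u \<in> units" "v \<in> units" for u v
    using that by (auto simp: Const_mult[symmetric])
  have one: "1 \<in> (units :: 'k mpoly5 set)"
    using Const_1 by (metis ComplI image_eqI singletonD zero_neq_one)
  have "?p \<in> bmonoid units fs"
    by (intro bmonoid_mult bmonoid_prod bmonoid_power units one s s')
  moreover have "?p \<in> II m"
    unfolding mem_II
  proof (intro conjI ballI)
    fix i assume "i \<in> {1..n}"
    then have "restr i (\<Prod>i\<in>{1..n}. s i) = 0"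
      using s(2)[of i] by (auto simp: is_hom_prod[OF is_hom_endo])
    then show "restr i ?p = 0" by (simp add: endo_simps)
  next
    show "?p \<in> ideal_pow Q m"
      by (intro is_ideal_mult_left is_ideal_pow power_mem_ideal_pow s'Q)
  qed
  ultimately show ?thesis by blast
qed

lemma unit_ideal: "is_ideal J \<Longrightarrow> J \<inter> units \<noteq> {} \<Longrightarrow> (J :: 'k mpoly5 set) = UNIV"
proof -
  assume J: "is_ideal J" "J \<inter> units \<noteq> {}"
  then obtain c where "c \<noteq> 0" "Const c \<in> J" by auto
  then have "Const (inverse c) * Const c \<in> J" using J is_ideal_mult_left by blast
  then have "1 \<in> J" using \<open>c \<noteq> 0\<close> by (simp add: Const_mult[symmetric])
  then show "J = UNIV" using ideal_eq_UNIV J by blast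
qed

lemma regular_seq_length_le: "regular_seq (II m) fs \<Longrightarrow> length fs \<le> 3"
proof (rule ccontr)
  assume reg: "regular_seq (II m) fs" and "\<not> length fs \<le> 3"
  then have len: "length (take 4 fs) = 4" by simp
  then obtain s where s: "s \<in> bmonoid units (take 4 fs)" "s \<in> II m" using bmonoid_meets_II by blast
  have "gen_ideal (II m \<union> set (take 4 fs)) \<inter> units \<noteq> {}"
  proof (rule bmonoid_regular_meets_units[OF is_ideal_II s])
    fix i assume "i < length (take 4 fs)"
    then show "nzd_mod (gen_ideal (II m \<union> set (take i (take 4 fs)))) (take 4 fs ! i)"
      using reg by (simp add: regular_seq_def nzd_mod_def min_absorb1)
  qed
  then have "gen_ideal (II m \<union> set (take 4 fs)) = UNIV" by (intro unit_ideal is_ideal_gen)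
  moreover have "gen_ideal (II m \<union> set (take 4 fs)) \<subseteq> gen_ideal (II m \<union> set fs)"
    by (intro gen_ideal_mono Un_mono set_take_subset order_refl)
  ultimately show False using reg by (auto simp: regular_seq_def)
qed

lemma prime_chain_length_le:
  assumes "\<forall>i\<le>d. prime_ideal (P i) \<and> II m \<subseteq> P i" "\<forall>i<d. P i \<subset> P (Suc i)"
  shows "d \<le> 3"
proof (rule ccontr)
  assume "\<not> d \<le> 3"
  have "\<exists>f. f \<in> P (Suc i) - P i" if "i < 4" for i
  proof -
    have "i < d" using that \<open>\<not> d \<le> 3\<close> by simp
    then have "P i \<subset> P (Suc i)" using assms(2) by blast
    then show ?thesis by blast
  qed
  then obtain g where g: "\<And>i. i < 4 \<Longrightarrow> g i \<in> P (Suc i) - P i" by metis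
  let ?fs = "map g [0..<4]"
  obtain s where s: "s \<in> bmonoid units ?fs" "s \<in> II m"
    using bmonoid_meets_II[of ?fs] by auto
  have "P (length ?fs) \<inter> units \<noteq> {}"
  proof (rule bmonoid_avoids_prime_chain[OF s(1)])
    show "s \<in> P 0" using s(2) assms(1) by auto
    show "prime_ideal (P i)" if "i \<le> length ?fs" for i
      using that assms(1) \<open>\<not> d \<le> 3\<close> by auto
    show "P i \<subseteq> P (Suc i)" if "i < length ?fs" for i
    proof -
      have "i < d" using that \<open>\<not> d \<le> 3\<close> by simp
      then show ?thesis using assms(2) by blast
    qed
    show "?fs ! i \<in> P (Suc i) - P i" if "i < length ?fs" for i
      using that g[of i] by simp
  qed
  moreover have "prime_ideal (P (length ?fs))" using assms(1) \<open>\<not> d \<le> 3\<close> by auto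
  ultimately show False using unit_ideal by (auto simp: prime_ideal_def)
qed

lemma krull_dim_II: "krull_dim_quot (II m) = 3"
  unfolding krull_dim_quot_def
proof (rule antisym)
  show "Sup {enat d |d. \<exists>P. (\<forall>i\<le>d. prime_ideal (P i) \<and> II m \<subseteq> P i) \<and> (\<forall>i<d. P i \<subset> P (Suc i))} \<le> 3"
    using prime_chain_length_le by (intro Sup_least) (force simp: numeral_eq_enat)
  let ?ker = "\<lambda>h :: 'k mpoly5 \<Rightarrow> 'k mpoly5. {f. h f = 0}"
  let ?h = "\<lambda>u v w. endo u (Const (a 1) * u) v (Const (b 1) * v) w"
  \<comment> \<open>Starting from the prime of the line with index 1, the coordinates
    \<open>z\<close>, \<open>x\<close> and \<open>l\<close> are set to zero in turn; each term is
    prime as the kernel of a map into a domain.\<close>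
  define P where "P = (\<lambda>i::nat. if i = 0 then ?ker (?h l x z) else if i = 1 then ?ker (?h l x 0)
    else if i = 2 then ?ker (?h l 0 0) else ?ker (?h 0 0 0))"
  have P0: "II m \<subseteq> P 0" using n_ge by (auto simp: P_def mem_II)
  have "P 0 \<subseteq> P 1"
  proof
    fix f assume "f \<in> P 0"
    then have "cut_z (?h l x z f) = 0" by (simp add: P_def endo_simps)
    then show "f \<in> P 1" by (simp add: P_def endo_comp endo_simps)
  qed
  moreover have "z \<in> P 1" "z \<notin> P 0" using coords_nonzero by (simp_all add: P_def endo_simps)
  ultimately have P1: "P 0 \<subset> P 1" by blast
  have "P 1 \<subseteq> P 2"
  proof
    fix f assume "f \<in> P 1"
    then have "endo l t 0 0 0 (?h l x 0 f) = 0" by (simp add: P_def endo_simps)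
    then show "f \<in> P 2" by (simp add: P_def endo_comp endo_simps)
  qed
  moreover have "x \<in> P 2" "x \<notin> P 1" using coords_nonzero by (simp_all add: P_def endo_simps)
  ultimately have P2: "P 1 \<subset> P 2" by blast
  have "P 2 \<subseteq> P 3"
  proof
    fix f assume "f \<in> P 2"
    then have "endo 0 0 0 0 0 (?h l 0 0 f) = 0" by (simp add: P_def endo_simps)
    then show "f \<in> P 3" by (simp add: P_def endo_comp endo_simps)
  qed
  moreover have "l \<in> P 3" "l \<notin> P 2" using coords_nonzero by (simp_all add: P_def endo_simps)
  ultimately have P3: "P 2 \<subset> P 3" by blast
  have "P i \<subset> P (Suc i)" if "i < 3" for i
    using P1 P2 P3 that by (auto simp: less_Suc_eq numeral_eq_Suc simp del: psubset_eq)
  moreover have "prime_ideal (P i)" for i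
    unfolding P_def using prime_ideal_kernel[OF is_hom_endo] by simp
  moreover have "II m \<subseteq> P i" if "i \<le> 3" for i
    using P0 P1 P2 P3 that by (auto simp: le_Suc_eq numeral_eq_Suc)
  ultimately have "(\<forall>i\<le>3. prime_ideal (P i) \<and> II m \<subseteq> P i) \<and> (\<forall>i<3. P i \<subset> P (Suc i))" by simp
  then have "enat 3 \<in> {enat d |d. \<exists>P. (\<forall>i\<le>d. prime_ideal (P i) \<and> II m \<subseteq> P i) \<and> (\<forall>i<d. P i \<subset> P (Suc i))}"
    by blast
  then show "3 \<le> Sup {enat d |d. \<exists>P. (\<forall>i\<le>d. prime_ideal (P i) \<and> II m \<subseteq> P i) \<and> (\<forall>i<d. P i \<subset> P (Suc i))}"
    unfolding numeral_eq_enat by (rule Sup_upper)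
qed

subsection \<open>Depth three when the fat line is fat enough\<close>

text \<open>Distinct slopes make \<open>vform i\<close> and \<open>vform j\<close> a basis of the
  span of \<open>x\<close> and \<open>y\<close>. The factor \<open>g\<close> is carried along so
  that the result applies to elements annihilated modulo \<open>J\<close>.\<close>

lemma linear_forms_pairwise:
  assumes "i \<in> {1..n}" "j \<in> {1..n}" "i \<noteq> j" "is_ideal J" "vform i * g \<in> J" "vform j * g \<in> J"
  shows "x * g \<in> J" "y * g \<in> J"
proof -
  let ?d = "b j - b i"
  have d: "?d \<noteq> 0" using assms(1-3) inj_onD[OF inj_b, of j i] by auto
  have "Const (inverse ?d) * (vform i * g - vform j * g) \<in> J"
    by (intro is_ideal_mult_left is_ideal_diff assms)
  moreover have "Const (inverse ?d) * (vform i * g - vform j * g) = Const (inverse ?d * ?d) * (x * g)"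
    by (simp only: Const_mult Const_diff) (simp add: algebra_simps)
  ultimately show x: "x * g \<in> J" using d by simp
  have "vform i * g + Const (b i) * (x * g) \<in> J"
    by (intro is_ideal_add is_ideal_mult_left x assms)
  then show "y * g \<in> J" by (simp add: algebra_simps)
qed

lemma vform_Q: "vform i \<in> Q"
  by (intro is_ideal_diff is_ideal_mult_left is_ideal_Q xy_Q)

text \<open>When an index \<open>k\<close> is added, an old generator omitting \<open>i\<close>
  becomes a new one after multiplication by either \<open>vform i\<close> or \<open>vform k\<close>.
  These two forms span \<open>x\<close> and \<open>y\<close>, so all of \<open>Q\<close> times an
  old generator lies in the new ideal.\<close>

lemma Q_pow_subset_products:
  assumes "finite N" "N \<noteq> {}" "N \<subseteq> {1..n}"
  shows "ideal_pow Q (card N - 1) \<subseteq> gen_ideal ((\<lambda>i. \<Prod>j\<in>N - {i}. vform j) ` N)"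
  using assms
proof (induction N rule: finite_ne_induct)
  case (singleton i)
  \<comment> \<open>For one index the product is empty and the exponent is 0, so both sides are the
    whole ring.\<close>
  have "1 \<in> gen_ideal ((\<lambda>k. \<Prod>j\<in>{i} - {k}. vform j) ` {i})" by (rule gen_ideal_base) simp
  then have "gen_ideal ((\<lambda>k. \<Prod>j\<in>{i} - {k}. vform j) ` {i}) = UNIV" by (rule ideal_eq_UNIV[OF is_ideal_gen])
  then show ?case by simp
next
  case (insert k N)
  let ?N = "insert k N"
  let ?J = "gen_ideal ((\<lambda>i. \<Prod>j\<in>?N - {i}. vform j) ` ?N)"
  have card: "card ?N - 1 = Suc (card N - 1)"
    using insert.hyps by (simp add: card_gt_0_iff Suc_diff_1)
  have mult: "is_ideal {c. a * c \<in> ?J}" for a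
    using is_ideal_gen[of "(\<lambda>i. \<Prod>j\<in>?N - {i}. vform j) ` ?N"]
    by (auto simp: is_ideal_def distrib_left mult.left_commute[of a])
  have gen: "a * (\<Prod>j\<in>N - {i}. vform j) \<in> ?J" if a: "a \<in> Q" and i: "i \<in> N" for a i
  proof -
    let ?g = "\<Prod>j\<in>N - {i}. vform j"
    have "vform i * ?g = (\<Prod>j\<in>?N - {k}. vform j)"
      using i insert.hyps by (simp add: prod.remove)
    then have 1: "vform i * ?g \<in> ?J" by (intro gen_ideal_base) auto
    have "?N - {i} = insert k (N - {i})" using i insert.hyps by auto
    then have "vform k * ?g = (\<Prod>j\<in>?N - {i}. vform j)"
      using insert.hyps by simp
    then have 2: "vform k * ?g \<in> ?J" using i by (intro gen_ideal_base) auto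
    have "i \<in> {1..n}" "k \<in> {1..n}" "i \<noteq> k" using i insert by blast+
    then have "x * ?g \<in> ?J" "y * ?g \<in> ?J"
      using linear_forms_pairwise[OF _ _ _ is_ideal_gen 1 2] by blast+
    then have "Q \<subseteq> {c. ?g * c \<in> ?J}"
      unfolding Q_def by (intro gen_ideal_least mult) (auto simp: mult.commute)
    then show ?thesis using a by (auto simp: mult.commute)
  qed
  show ?case
    unfolding card
  proof (rule ideal_pow_Suc_least[OF is_ideal_gen])
    fix a c assume a: "a \<in> Q" and c: "c \<in> ideal_pow Q (card N - 1)"
    have "gen_ideal ((\<lambda>i. \<Prod>j\<in>N - {i}. vform j) ` N) \<subseteq> {c. a * c \<in> ?J}"
      using gen[OF a] by (intro gen_ideal_least mult) auto
    then show "a * c \<in> ?J" using c insert by auto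
  qed
qed

text \<open>For \<open>m = n - 1\<close> and a product \<open>g\<close> of all
  \<open>vform j\<close> with \<open>j\<close> different from \<open>i\<close>, the element
  \<open>hform i * g\<close> lies in every component and is congruent to \<open>t * g\<close> modulo
  \<open>l\<close>. Larger \<open>m\<close> follow by multiplying such congruences by elements of
  \<open>Q\<close>.\<close>

lemma t_times_Q_pow:
  assumes "n - 1 \<le> m" "f \<in> ideal_pow Q m"
  shows "t * f \<in> gen_ideal (insert l (II m))"
  using assms
proof (induction m arbitrary: f rule: dec_induct)
  case base
  let ?J = "gen_ideal (insert l (II (n - 1)))"
  have "is_ideal {f. t * f \<in> ?J}"
    using is_ideal_gen[of "insert l (II (n - 1))"]
    by (auto simp: is_ideal_def distrib_left mult.left_commute[of t])
  moreover have "t * (\<Prod>j\<in>{1..n} - {i}. vform j) \<in> ?J" if i: "i \<in> {1..n}" for i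
  proof -
    let ?g = "\<Prod>j\<in>{1..n} - {i}. vform j"
    have "hform i * ?g \<in> PP j" if j: "j \<in> {1..n}" for j
    proof (cases "i = j")
      case True
      then show ?thesis using forms_PP is_ideal_PP by (auto intro: is_ideal_mult_right)
    next
      case False
      then have "?g = vform j * (\<Prod>j\<in>{1..n} - {i} - {j}. vform j)"
        using j by (intro prod.remove) auto
      then show ?thesis
        using forms_PP(2)[of j] is_ideal_PP by (metis is_ideal_mult_left is_ideal_mult_right)
    qed
    moreover have "?g \<in> ideal_pow Q (card ({1..n} - {i}))"
      by (intro prod_mem_ideal_pow vform_Q) simp
    then have "hform i * ?g \<in> ideal_pow Q (n - 1)"
      using i by (intro is_ideal_mult_left is_ideal_pow) simp
    ultimately have "hform i * ?g \<in> II (n - 1)" by (simp add: II_def)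
    then have "t * ?g - (Const (a i) * ?g) * l \<in> II (n - 1)" by (simp add: algebra_simps)
    then show ?thesis unfolding gen_ideal_insert[OF is_ideal_II] by blast
  qed
  ultimately have "gen_ideal ((\<lambda>i. \<Prod>j\<in>{1..n} - {i}. vform j) ` {1..n}) \<subseteq> {f. t * f \<in> ?J}"
    by (intro gen_ideal_least) auto
  moreover have "ideal_pow Q (card {1..n} - 1) \<subseteq> gen_ideal ((\<lambda>i. \<Prod>j\<in>{1..n} - {i}. vform j) ` {1..n})"
    using n_ge by (intro Q_pow_subset_products) auto
  ultimately show ?case using base by auto
next
  case (step m)
  let ?J = "gen_ideal (insert l (II (Suc m)))"
  have "is_ideal {f. t * f \<in> ?J}"
    using is_ideal_gen[of "insert l (II (Suc m))"]
    by (auto simp: is_ideal_def distrib_left mult.left_commute[of t])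
  then have "ideal_pow Q (Suc m) \<subseteq> {f. t * f \<in> ?J}"
  proof (rule ideal_pow_Suc_least)
    fix c g assume c: "c \<in> Q" and "g \<in> ideal_pow Q m"
    then obtain r where r: "t * g - r * l \<in> II m"
      using step.IH gen_ideal_insert[OF is_ideal_II] by blast
    then have "c * (t * g - r * l) \<in> ideal_pow Q (Suc m)"
      by (intro ideal_pow_Suc_mem c) (simp add: II_def)
    moreover have "c * (t * g - r * l) \<in> PP i" if "i \<in> {1..n}" for i
      using r that by (intro is_ideal_mult_left is_ideal_PP) (auto simp: II_def)
    ultimately have "c * (t * g - r * l) \<in> II (Suc m)" by (simp add: II_def)
    then have "t * (c * g) - (c * r) * l \<in> II (Suc m)" by (simp add: algebra_simps)
    then show "c * g \<in> {f. t * f \<in> ?J}" unfolding gen_ideal_insert[OF is_ideal_II] by blast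
  qed
  then show ?case using step.prems by blast
qed

section \<open>The quotient by \<open>l\<close> and \<open>z\<close>\<close>

abbreviation cut_lz :: "'k mpoly5 \<Rightarrow> 'k mpoly5" where "cut_lz \<equiv> endo 0 t x y 0"
abbreviation cut_ltz :: "'k mpoly5 \<Rightarrow> 'k mpoly5" where "cut_ltz \<equiv> endo 0 0 x y 0"
abbreviation vpoint :: "nat \<Rightarrow> 'k mpoly5 \<Rightarrow> 'k mpoly5" where "vpoint i \<equiv> endo 0 0 x (Const (b i) * x) 0"

lemma vpoint_II: "f \<in> II m \<Longrightarrow> i \<in> {1..n} \<Longrightarrow> vpoint i f = 0"
proof -
  assume "f \<in> II m" "i \<in> {1..n}"
  then have "endo 0 0 x y 0 (restr i f) = 0" by (simp add: mem_II endo_simps)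
  then show "vpoint i f = 0" by (simp add: endo_comp endo_simps)
qed

text \<open>After \<open>l\<close> and \<open>z\<close> are set to zero, the polynomial splits into
  a part free of \<open>t\<close> and a multiple of \<open>t\<close>. The latter is \<open>t\<close>
  times an element of \<open>ideal_pow Q m\<close> and is covered by \<open>t_times_Q_pow\<close>;
  the former restricts on the lines to the values of \<open>vpoint\<close>, so it lies in
  \<open>II m\<close> itself.\<close>

lemma mem_insert_lz_II:
  assumes "n - 1 \<le> m"
  shows "f \<in> gen_ideal (insert l (insert z (II m))) \<longleftrightarrow>
    cut_lz f \<in> ideal_pow Q m \<and> (\<forall>i\<in>{1..n}. vpoint i f = 0)"
proof
  let ?K = "cut_lz -` ideal_pow Q m \<inter> (\<Inter>i\<in>{1..n}. {f. vpoint i f = 0})"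
  assume f: "f \<in> gen_ideal (insert l (insert z (II m)))"
  have "gen_ideal (insert l (insert z (II m))) \<subseteq> ?K"
  proof (rule gen_ideal_least)
    show "is_ideal ?K"
      by (intro is_ideal_Int is_ideal_INT is_ideal_vimage is_ideal_kernel is_hom_endo is_ideal_pow)
    show "insert l (insert z (II m)) \<subseteq> ?K"
      using is_ideal_zero[OF is_ideal_pow] endo_Q_pow[OF xy_Q, of _ m] vpoint_II
      by (auto simp: endo_coords mem_II)
  qed
  then show "cut_lz f \<in> ideal_pow Q m \<and> (\<forall>i\<in>{1..n}. vpoint i f = 0)" using f by auto
next
  let ?J = "gen_ideal (insert l (insert z (II m)))"
  assume f: "cut_lz f \<in> ideal_pow Q m \<and> (\<forall>i\<in>{1..n}. vpoint i f = 0)"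
  have lzJ: "l \<in> ?J" "z \<in> ?J" by (simp_all add: gen_ideal_base)
  have fJ: "f - cut_lz f \<in> ?J"
  proof (rule congruent_endo[OF is_hom_endo is_ideal_gen])
    show "u - cut_lz u \<in> ?J" if "u \<in> {l, t, x, y, z}" for u
      using that is_ideal_zero[OF is_ideal_gen] lzJ by (auto simp: endo_coords)
  qed (simp add: endo_coords)
  have "cut_lz f - cut_ltz (cut_lz f) \<in> gen_ideal {t}"
  proof -
    have "g - endo l 0 x y z g \<in> gen_ideal {t}" for g
    proof (rule congruent_endo[OF is_hom_endo is_ideal_gen])
      show "u - endo l 0 x y z u \<in> gen_ideal {t}" if "u \<in> {l, t, x, y, z}" for u
        using that is_ideal_zero[OF is_ideal_gen] by (auto simp: endo_coords intro: gen_ideal_base)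
    qed (simp add: endo_coords)
    moreover have "endo l 0 x y z (cut_lz f) = cut_ltz (cut_lz f)"
      by (simp add: endo_comp endo_simps)
    ultimately show ?thesis by metis
  qed
  then obtain g where g: "cut_lz f - cut_ltz (cut_lz f) = t * g"
    by (auto simp: gen_ideal_single)
  have c0: "cut_ltz (cut_lz f) \<in> ideal_pow Q m" using f endo_Q_pow[OF xy_Q] by blast
  have "cut_lz f - cut_ltz (cut_lz f) \<in> ideal_pow Q m" using f c0 by (intro is_ideal_diff) auto
  then have "t * g \<in> ideal_pow Q m" unfolding g .
  then have "g \<in> ideal_pow Q m"
    by (rule nzd_modD[OF nzd_mod_Q_pow, rotated]) (simp add: rees_coords coords_nonzero)
  then have "t * g \<in> gen_ideal (insert l (II m))" by (rule t_times_Q_pow[OF assms])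
  moreover have "gen_ideal (insert l (II m)) \<subseteq> ?J" by (intro gen_ideal_mono) auto
  ultimately have "cut_lz f - cut_ltz (cut_lz f) \<in> ?J" unfolding g by blast
  moreover have "cut_ltz (cut_lz f) \<in> II m"
    unfolding mem_II
  proof (intro conjI ballI c0)
    fix i assume "i \<in> {1..n}"
    then have "vpoint i f = 0" using f by blast
    then show "restr i (cut_ltz (cut_lz f)) = 0" by (simp add: endo_comp endo_simps)
  qed
  then have "cut_ltz (cut_lz f) \<in> ?J" by (simp add: gen_ideal_base)
  ultimately have "cut_lz f \<in> ?J" using is_ideal_diff_cancel[OF is_ideal_gen] by blast
  then show "f \<in> ?J" by (rule is_ideal_diff_cancel[OF is_ideal_gen fJ])
qed

text \<open>\<open>t\<close> vanishes under every \<open>vpoint i\<close>, and \<open>x\<close> lies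
  in \<open>Q\<close>. Their sum escapes both: it has image \<open>x\<close> under
  \<open>vpoint i\<close> and component \<open>t\<close> in degree 0.\<close>

lemma nzd_t_plus_x:
  assumes "n - 1 \<le> m"
  shows "nzd_mod (gen_ideal (insert l (insert z (II m)))) (t + x)"
  unfolding nzd_mod_def mem_insert_lz_II[OF assms]
proof (intro allI impI conjI ballI)
  fix g assume g: "cut_lz ((t + x) * g) \<in> ideal_pow Q m \<and> (\<forall>i\<in>{1..n}. vpoint i ((t + x) * g) = 0)"
  then have "(t + x) * cut_lz g \<in> ideal_pow Q m" by (simp add: endo_simps)
  moreover have "coeff (rees (t + x)) 0 \<noteq> 0" by (simp add: rees_simps coords_nonzero)
  ultimately show "cut_lz g \<in> ideal_pow Q m" using nzd_modD[OF nzd_mod_Q_pow] by blast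
  fix i assume "i \<in> {1..n}"
  then have "vpoint i ((t + x) * g) = 0" using g by blast
  then show "vpoint i g = 0" by (simp add: endo_simps coords_nonzero)
qed

lemma regular_triple:
  assumes "n - 1 \<le> m"
  shows "regular_seq (II m) [z, l, t + x]"
  unfolding regular_seq_def
proof (intro conjI allI impI)
  show sub: "set [z, l, t + x] \<subseteq> irrel"
    using coords_irrel is_ideal_add[OF is_ideal_irrel] by simp
  have "gen_ideal (II m \<union> set [z, l, t + x]) \<subseteq> irrel"
    using sub II_subset_irrel by (intro gen_ideal_least is_ideal_irrel) auto
  then show "gen_ideal (II m \<union> set [z, l, t + x]) \<noteq> UNIV" using irrel_proper by auto
  fix i g assume "i < length [z, l, t + x]"
    "[z, l, t + x] ! i * g \<in> gen_ideal (II m \<union> set (take i [z, l, t + x]))"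
  moreover have "nzd_mod (gen_ideal (II m)) z" using nzd_z is_ideal_II by simp
  moreover have "insert z (insert l J) = insert l (insert z J)" for J :: "'k mpoly5 set" by auto
  ultimately show "g \<in> gen_ideal (II m \<union> set (take i [z, l, t + x]))"
    using nzd_modD[OF nzd_l_insert_z] nzd_modD[OF nzd_t_plus_x[OF assms]]
    by (auto simp: less_Suc_eq nzd_mod_def)
qed

subsection \<open>Depth at most two otherwise\<close>

text \<open>A form vanishing on the lines \<open>1\<close> to \<open>n - 1\<close> but not on line
  \<open>n\<close>. Using \<open>hform\<close> for line \<open>n - 1\<close> keeps the degree in
  \<open>x\<close>, \<open>y\<close> down to \<open>n - 2\<close>.\<close>

definition socle :: "'k mpoly5" where
  "socle = hform (n - 1) * (\<Prod>i\<in>{1..n - 2}. vform i)"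

text \<open>The factor \<open>?g\<close> lies in \<open>ideal_pow Q (n - 2)\<close> and vanishes on
  all lines but the last two, so multiplying it by an element of \<open>PP (n - 1)\<close> and one
  of \<open>PP n\<close> gives an element of \<open>II m\<close>. The multiples of
  \<open>socle\<close> by \<open>t\<close>, \<open>vform (n - 1)\<close> and \<open>vform n\<close>
  are such products up to multiples of \<open>l\<close>.\<close>

lemma socle_annihilated:
  assumes "m < n - 1" "v \<in> irrel"
  shows "v * socle \<in> gen_ideal (insert l (insert z (II m)))"
proof -
  let ?J = "gen_ideal (insert l (insert z (II m)))"
  let ?g = "\<Prod>i\<in>{1..n - 2}. vform i"
  have idx: "n - 1 \<in> {1..n}" "n \<in> {1..n}" "n - 1 \<noteq> n" using n_ge by auto
  have J: "is_ideal {v. v * socle \<in> ?J}"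
    using is_ideal_gen[of "insert l (insert z (II m))"]
    by (auto simp: is_ideal_def distrib_right mult.assoc)
  have IJ: "II m \<subseteq> ?J" using gen_ideal_superset[of "insert l (insert z (II m))"] by auto
  have lzJ: "l \<in> ?J" "z \<in> ?J" by (simp_all add: gen_ideal_base)
  have gQ: "r * ?g \<in> ideal_pow Q m" for r
  proof -
    have "?g \<in> ideal_pow Q (card {1..n - 2})" by (intro prod_mem_ideal_pow vform_Q) simp
    moreover have "ideal_pow Q (card {1..n - 2}) \<subseteq> ideal_pow Q m"
      using assms by (intro ideal_pow_antimono) auto
    ultimately show ?thesis by (auto intro: is_ideal_mult_left)
  qed
  have gPP: "?g \<in> PP i" if "i \<in> {1..n}" "i \<noteq> n - 1" "i \<noteq> n" for i
  proof -
    have "?g = vform i * (\<Prod>j\<in>{1..n - 2} - {i}. vform j)" using that by (intro prod.remove) auto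
    then show ?thesis using forms_PP(2)[of i] is_ideal_PP by (metis is_ideal_mult_right)
  qed
  have mem: "r * r' * ?g \<in> II m" if "r \<in> PP (n - 1)" "r' \<in> PP n" for r r'
  proof -
    have "r * r' * ?g \<in> PP i" if "i \<in> {1..n}" for i
      using gPP[OF that] is_ideal_mult_left[OF is_ideal_PP] is_ideal_mult_right[OF is_ideal_PP]
        \<open>r \<in> PP (n - 1)\<close> \<open>r' \<in> PP n\<close> by metis
    then show ?thesis using gQ by (simp add: II_def)
  qed
  have "l * socle \<in> ?J" "z * socle \<in> ?J" using lzJ by (auto intro: is_ideal_mult_right)
  moreover have ts: "t * socle \<in> ?J"
  proof -
    have "hform (n - 1) * hform n * ?g \<in> ?J" using mem[OF forms_PP(1) forms_PP(1)] IJ by blast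
    then have "hform (n - 1) * hform n * ?g + l * (Const (a n) * socle) \<in> ?J"
      by (rule is_ideal_add[OF is_ideal_gen _ is_ideal_mult_right[OF is_ideal_gen lzJ(1)]])
    then show ?thesis by (simp add: socle_def algebra_simps)
  qed
  moreover have "x * socle \<in> ?J" "y * socle \<in> ?J"
  proof -
    have "vform n * socle \<in> ?J"
      using mem[OF forms_PP(1) forms_PP(2)] IJ by (auto simp: socle_def ac_simps)
    moreover have "vform (n - 1) * socle \<in> ?J"
    proof -
      \<comment> \<open>Replacing \<open>hform n\<close> by \<open>hform (n - 1)\<close> costs a
        multiple of \<open>l\<close>.\<close>
      have "vform (n - 1) * hform n * ?g \<in> ?J" using mem[OF forms_PP(2) forms_PP(1)] IJ by blast
      then have "vform (n - 1) * hform n * ?g + l * (Const (a n - a (n - 1)) * vform (n - 1) * ?g) \<in> ?J"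
        by (rule is_ideal_add[OF is_ideal_gen _ is_ideal_mult_right[OF is_ideal_gen lzJ(1)]])
      then show ?thesis by (simp add: socle_def Const_diff algebra_simps)
    qed
    ultimately show "x * socle \<in> ?J" "y * socle \<in> ?J"
      using linear_forms_pairwise[OF idx is_ideal_gen] by blast+
  qed
  ultimately have "irrel \<subseteq> {v. v * socle \<in> ?J}"
    by (intro irrel_least[OF J]) simp
  then show ?thesis using assms(2) by blast
qed

text \<open>Each \<open>vform k\<close> generates the kernel of the substitution
  \<open>y = b k * x\<close>, and distinct slopes keep the earlier factors nonzero under it; so the
  factors can be divided out one at a time.\<close>

lemma prod_vform_dvd:
  assumes "finite N" "N \<subseteq> {1..n}" "\<And>i. i \<in> N \<Longrightarrow> endo l t x (Const (b i) * x) z w = 0"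
  shows "(\<Prod>i\<in>N. vform i) dvd w"
  using assms
proof (induction N rule: finite_induct)
  case (insert k N)
  let ?h = "endo l t x (Const (b k) * x) z"
  obtain q where q: "w = (\<Prod>i\<in>N. vform i) * q" using insert by (auto elim: dvdE)
  have "?h (vform i) \<noteq> 0" if "i \<in> N" for i
  proof -
    have "?h (vform i) = Const (b k - b i) * x" by (simp add: endo_simps Const_diff algebra_simps)
    moreover have "k \<in> {1..n}" "i \<in> {1..n}" "k \<noteq> i" using that insert.hyps insert.prems(1) by auto
    then have "b k \<noteq> b i" using inj_onD[OF inj_b] by blast
    ultimately show ?thesis using coords_nonzero by simp
  qed
  then have "?h (\<Prod>i\<in>N. vform i) \<noteq> 0" using insert.hyps by (simp add: is_hom_prod[OF is_hom_endo])
  moreover have "?h w = 0" using insert.prems by auto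
  ultimately have "?h q = 0" by (simp add: q is_hom_mult[OF is_hom_endo])
  moreover have "q - ?h q \<in> gen_ideal {vform k}"
  proof (rule congruent_endo[OF is_hom_endo is_ideal_gen])
    show "u - ?h u \<in> gen_ideal {vform k}" if "u \<in> {l, t, x, y, z}" for u
      using that is_ideal_zero[OF is_ideal_gen] by (auto simp: endo_coords intro: gen_ideal_base)
  qed (simp add: endo_coords)
  ultimately have "vform k dvd q" by (simp add: gen_ideal_single)
  then show ?case using insert.hyps by (simp add: q mult.commute mult_dvd_mono)
qed simp

text \<open>If \<open>socle\<close> were \<open>v * l\<close> modulo the ideal and \<open>z\<close>,
  then on every line \<open>v\<close> would restrict to \<open>socle\<close> divided by
  \<open>l\<close>. Vanishing on the first \<open>n - 1\<close> lines forces order at least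
  \<open>n - 1\<close> in \<open>x\<close>, \<open>y\<close>, while line \<open>n\<close> prescribes
  a nonzero multiple of \<open>x ^ (n - 2)\<close>.\<close>

lemma socle_notin: "socle \<notin> gen_ideal (insert l (insert z (II m)))"
proof
  assume "socle \<in> gen_ideal (insert l (insert z (II m)))"
  then have "socle \<in> gen_ideal (insert l (gen_ideal (insert z (II m))))"
    by (simp add: gen_ideal_insert_gen)
  then obtain v where "socle - v * l \<in> gen_ideal (insert z (II m))"
    by (auto simp: gen_ideal_insert)
  then have mem: "socle - cut_z v * l \<in> II m"
    by (simp add: mem_insert_z_II socle_def endo_simps)
  \<comment> \<open>The comparison uses the part of \<open>v\<close> free of \<open>l\<close>,
    \<open>t\<close>, \<open>z\<close>: on each line \<open>t\<close> is a multiple of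
    \<open>l\<close>, so setting \<open>l\<close> to zero after restriction amounts to restricting
    \<open>w\<close>.\<close>
  define w where "w = cut_ltz v"
  have eq: "restr i socle = restr i (cut_z v) * l" if "i \<in> {1..n}" for i
    using mem that by (simp add: mem_II endo_simps)
  have point: "endo l t x (Const (b i) * x) z w = cut_ltz (restr i (cut_z v))" for i
    unfolding w_def by (simp add: endo_comp endo_simps)
  have "endo l t x (Const (b i) * x) z w = 0" if i: "i \<in> {1..n - 1}" for i
  proof -
    have "restr i socle = 0"
    proof (cases "i = n - 1")
      case True
      then show ?thesis by (simp add: socle_def endo_simps)
    next
      case False
      then have "i \<in> {1..n - 2}" using i by auto
      then have "restr i (\<Prod>i\<in>{1..n - 2}. vform i) = 0"
        by (auto simp: is_hom_prod[OF is_hom_endo] endo_simps intro!: prod_zero)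
      then show ?thesis by (simp add: socle_def endo_simps)
    qed
    then have "restr i (cut_z v) = 0" using eq[of i] i coords_nonzero by auto
    then show ?thesis unfolding point by (simp add: endo_simps)
  qed
  then have "(\<Prod>i\<in>{1..n - 1}. vform i) dvd w" by (intro prod_vform_dvd) auto
  then obtain q where "w = (\<Prod>i\<in>{1..n - 1}. vform i) * q" by (auto elim: dvdE)
  moreover have "(\<Prod>i\<in>{1..n - 1}. vform i) \<in> ideal_pow Q (card {1..n - 1})"
    by (intro prod_mem_ideal_pow vform_Q) simp
  ultimately have "w \<in> ideal_pow Q (n - 1)" by (auto intro: is_ideal_mult_right)
  then have "endo l t x (Const (b n) * x) z w \<in> ideal_pow Q (n - 1)"
    by (intro endo_Q_pow xy_Q is_ideal_mult_left[OF is_ideal_Q])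
  moreover
  \<comment> \<open>\<open>c\<close> collects the scalars of the factors on line \<open>n\<close>;
    it is nonzero by \<open>a_neq\<close> and \<open>inj_b\<close>.\<close>
  define c where "c = (a n - a (n - 1)) * (\<Prod>i\<in>{1..n - 2}. b n - b i)"
  have "restr n socle = Const c * x ^ (n - 2) * l"
  proof -
    have "restr n (vform i) = Const (b n - b i) * x" for i
      by (simp add: endo_simps Const_diff algebra_simps)
    moreover have "restr n (hform (n - 1)) = Const (a n - a (n - 1)) * l"
      by (simp add: endo_simps Const_diff algebra_simps)
    ultimately show ?thesis
      by (simp add: socle_def c_def is_hom_mult[OF is_hom_endo] is_hom_prod[OF is_hom_endo]
          prod.distrib Const_mult is_hom_prod[OF is_hom_Const])
  qed
  then have "restr n (cut_z v) = Const c * x ^ (n - 2)"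
    using eq[of n] n_ge coords_nonzero(1) by simp
  then have "endo l t x (Const (b n) * x) z w = Const c * x ^ (n - 2)"
    unfolding point by (simp add: endo_simps)
  ultimately have "Const c * x ^ (n - 2) \<in> ideal_pow Q (n - 1)" by simp
  \<comment> \<open>Degree \<open>n - 2\<close> is the last one in which membership in
    \<open>ideal_pow Q (n - 1)\<close> forces vanishing, and it is exactly where this monomial
    sits.\<close>
  moreover have "n - 2 < n - 1" using n_ge by simp
  ultimately have "coeff (rees (Const c * x ^ (n - 2))) (n - 2) = 0" unfolding mem_Q_pow by blast
  moreover have "[:0, x:] ^ k = monom (x ^ k) k" for k
    by (induction k) (simp_all add: monom_0 monom_Suc smult_monom)
  ultimately have "Const c * x ^ (n - 2) = 0" by (simp add: rees_simps)
  then have "c = 0" using coords_nonzero by simp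
  moreover have "b n \<noteq> b i" if "i \<in> {1..n - 2}" for i
  proof -
    have "n \<in> {1..n}" "i \<in> {1..n}" "n \<noteq> i" using that n_ge by auto
    then show ?thesis using inj_onD[OF inj_b] by blast
  qed
  ultimately show False using a_neq by (auto simp: c_def)
qed

lemma regular_seq_length_le_2:
  assumes "m < n - 1" "regular_seq (II m) fs"
  shows "length fs \<le> 2"
proof (rule ccontr)
  assume "\<not> ?thesis"
  then have "Suc (Suc (Suc 0)) \<le> length fs" by simp
  then obtain f1 f2 f3 gs where fs: "fs = f1 # f2 # f3 # gs"
    by (auto simp: Suc_le_length_iff)
  have irr: "f1 \<in> irrel" "f2 \<in> irrel" "f3 \<in> irrel"
    using assms(2) by (auto simp: regular_seq_def fs)
  have nzd: "nzd_mod (gen_ideal (II m \<union> set (take i fs))) (fs ! i)" if "i < length fs" for i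
    using assms(2) that by (auto simp: regular_seq_def nzd_mod_def)
  have "socle \<in> gen_ideal (insert l (insert z (II m)))"
  proof (rule no_regular_triple[OF is_ideal_II _ _ _ nzd_z nzd_l_insert_z])
    show "nzd_mod (II m) f1" using nzd[of 0] is_ideal_II by (simp add: fs)
    show "nzd_mod (gen_ideal (insert f1 (II m))) f2" using nzd[of 1] by (simp add: fs)
    have "insert f1 (insert f2 (II m)) = insert f2 (insert f1 (II m))" by auto
    then show "nzd_mod (gen_ideal (insert f2 (insert f1 (II m)))) f3" using nzd[of 2] by (simp add: fs)
  qed (use socle_annihilated[OF assms(1)] irr in auto)
  then show False using socle_notin by blast
qed

lemma cohen_macaulay_II_iff: "cohen_macaulay_quot (II m) \<longleftrightarrow> n - 1 \<le> m"
proof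
  assume "n - 1 \<le> m"
  then have "enat (length [z, l, t + x]) \<le> depth_quot (II m)"
    unfolding depth_quot_def using regular_triple by (intro Sup_upper) blast
  moreover have "depth_quot (II m) \<le> 3"
    unfolding depth_quot_def using regular_seq_length_le
    by (intro Sup_least) (force simp: numeral_eq_enat)
  ultimately have "depth_quot (II m) = 3" by (simp add: numeral_eq_enat eval_nat_numeral)
  then show "cohen_macaulay_quot (II m)" by (simp add: cohen_macaulay_quot_def krull_dim_II)
next
  assume cm: "cohen_macaulay_quot (II m)"
  show "n - 1 \<le> m"
  proof (rule ccontr)
    assume "\<not> n - 1 \<le> m"
    then have "depth_quot (II m) \<le> 2"
      unfolding depth_quot_def using regular_seq_length_le_2[of m]
      by (intro Sup_least) (force simp: numeral_eq_enat)
    then show False using cm by (simp add: cohen_macaulay_quot_def krull_dim_II)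
  qed
qed

end

section \<open>Comparison with the given forms, which differ from the normalised ones by nonzero
  scalars\<close>

lemma (in configuration) intersection_eq_II:
  assumes A: "\<And>i. i \<in> {1..n} \<Longrightarrow> A i = Const (d i) * hform i" "\<And>i. i \<in> {1..n} \<Longrightarrow> d i \<noteq> 0"
    and B: "\<And>i. i \<in> {1..n} \<Longrightarrow> B i = Const (g i) * vform i" "\<And>i. i \<in> {1..n} \<Longrightarrow> g i \<noteq> 0"
  shows "(\<Inter>i\<in>{1..n}. gen_ideal {A i, B i}) \<inter> ideal_pow (gen_ideal {B 1, B 2}) m = II m"
proof -
  have scale: "f \<in> J \<longleftrightarrow> Const c * f \<in> J" if "is_ideal J" "c \<noteq> 0" for J f and c :: 'k
  proof -
    have "f = Const (inverse c) * (Const c * f)"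
      using that(2) by (simp add: mult.assoc[symmetric] Const_mult[symmetric])
    then show ?thesis using is_ideal_mult_left[OF that(1)] by metis
  qed
  have "gen_ideal {A i, B i} = PP i" if i: "i \<in> {1..n}" for i
  proof
    have "A i \<in> PP i" "B i \<in> PP i"
      unfolding A(1)[OF i] B(1)[OF i] by (intro is_ideal_mult_left is_ideal_PP forms_PP)+
    then show "gen_ideal {A i, B i} \<subseteq> PP i"
      by (intro gen_ideal_least is_ideal_PP) simp
    have "A i \<in> gen_ideal {A i, B i}" "B i \<in> gen_ideal {A i, B i}" by (simp_all add: gen_ideal_base)
    then have "hform i \<in> gen_ideal {A i, B i}" "vform i \<in> gen_ideal {A i, B i}"
      using scale[OF is_ideal_gen A(2)[OF i], of "hform i" "{A i, B i}"]
        scale[OF is_ideal_gen B(2)[OF i], of "vform i" "{A i, B i}"]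
      unfolding A(1)[OF i, symmetric] B(1)[OF i, symmetric] by blast+
    then show "PP i \<subseteq> gen_ideal {A i, B i}"
      unfolding PP_def by (intro gen_ideal_least) auto
  qed
  moreover have "gen_ideal {B 1, B 2} = Q"
  proof
    have i: "1 \<in> {1..n}" "2 \<in> {1..n}" "1 \<noteq> (2::nat)" using n_ge by auto
    have "B 1 \<in> Q" "B 2 \<in> Q"
      unfolding B(1)[OF i(1)] B(1)[OF i(2)] by (intro is_ideal_mult_left is_ideal_Q vform_Q)+
    then show "gen_ideal {B 1, B 2} \<subseteq> Q"
      by (intro gen_ideal_least is_ideal_Q) simp
    have "B 1 \<in> gen_ideal {B 1, B 2}" "B 2 \<in> gen_ideal {B 1, B 2}" by (simp_all add: gen_ideal_base)
    then have "vform 1 \<in> gen_ideal {B 1, B 2}" "vform 2 \<in> gen_ideal {B 1, B 2}"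
      using scale[OF is_ideal_gen B(2)[OF i(1)], of "vform 1" "{B 1, B 2}"]
        scale[OF is_ideal_gen B(2)[OF i(2)], of "vform 2" "{B 1, B 2}"]
      unfolding B(1)[OF i(1), symmetric] B(1)[OF i(2), symmetric] by blast+
    then have "vform 1 * 1 \<in> gen_ideal {B 1, B 2}" "vform 2 * 1 \<in> gen_ideal {B 1, B 2}" by simp_all
    then have "x * 1 \<in> gen_ideal {B 1, B 2}" "y * 1 \<in> gen_ideal {B 1, B 2}"
      using linear_forms_pairwise[OF i is_ideal_gen] by blast+
    then show "Q \<subseteq> gen_ideal {B 1, B 2}"
      unfolding Q_def by (intro gen_ideal_least) auto
  qed
  ultimately show ?thesis by (simp add: II_def)
qed

section \<open>Choice of coordinates\<close>

lemma linear_form_expansion: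
  assumes "finite V" "\<And>mo. mo \<in> Poly_Mapping.keys p \<Longrightarrow> \<exists>v\<in>V. mo = Poly_Mapping.single v 1"
  shows "p = (\<Sum>v\<in>V. Const (Poly_Mapping.lookup p (Poly_Mapping.single v 1)) * Var v)"
proof (rule poly_mapping_eqI)
  fix mo
  have inj: "Poly_Mapping.single u (1::nat) = Poly_Mapping.single v 1 \<longleftrightarrow> u = v" for u v :: var
    by (metis lookup_single_eq lookup_single_not_eq zero_neq_one)
  have "Poly_Mapping.lookup (\<Sum>v\<in>V. Const (Poly_Mapping.lookup p (Poly_Mapping.single v 1)) * Var v) mo
      = (\<Sum>v\<in>V. if Poly_Mapping.single v 1 = mo then Poly_Mapping.lookup p mo else 0)"
    unfolding lookup_sum Const_def Var_def mult_single
    by (intro sum.cong) (auto simp: lookup_single)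
  also have "\<dots> = Poly_Mapping.lookup p mo"
  proof (cases "\<exists>v\<in>V. mo = Poly_Mapping.single v 1")
    case True
    then obtain v where "v \<in> V" "mo = Poly_Mapping.single v 1" by blast
    then show ?thesis using assms(1) inj by (simp add: sum.delta)
  next
    case False
    then have "mo \<notin> Poly_Mapping.keys p" using assms(2) by blast
    then have "Poly_Mapping.lookup p mo = 0" by (simp add: in_keys_iff)
    then show ?thesis by (auto intro!: sum.neutral)
  qed
  finally show "Poly_Mapping.lookup p mo = Poly_Mapping.lookup
      (\<Sum>v\<in>V. Const (Poly_Mapping.lookup p (Poly_Mapping.single v 1)) * Var v) mo" ..
qed

lemma monomial_eq_single:
  assumes "\<And>u. u \<noteq> v \<Longrightarrow> Poly_Mapping.lookup mo u = 0" "Poly_Mapping.lookup mo v = 1"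
  shows "mo = Poly_Mapping.single v (1::nat)"
  using assms by (intro poly_mapping_eqI) (auto simp: lookup_single when_def)

lemma bihomog_1_0_expansion:
  assumes "bihomog 1 0 p"
  shows "\<exists>c c'. p = Const c * Var S + Const c' * Var T"
proof -
  have "\<exists>v\<in>{S, T}. mo = Poly_Mapping.single v 1" if "mo \<in> Poly_Mapping.keys p" for mo
  proof -
    let ?k = "Poly_Mapping.lookup mo"
    have "?k S + ?k T = 1" "?k X + ?k Y + ?k Z = 0" using assms that by (auto simp: bihomog_def)
    then consider "?k S = 1" "?k T = 0" "?k X = 0" "?k Y = 0" "?k Z = 0"
      | "?k S = 0" "?k T = 1" "?k X = 0" "?k Y = 0" "?k Z = 0" by linarith
    then show ?thesis
    proof cases
      case 1
      then have "mo = Poly_Mapping.single S 1"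
        by (intro monomial_eq_single) (metis var.exhaust)+
      then show ?thesis by blast
    next
      case 2
      then have "mo = Poly_Mapping.single T 1"
        by (intro monomial_eq_single) (metis var.exhaust)+
      then show ?thesis by blast
    qed
  qed
  then have "p = (\<Sum>v\<in>{S, T}. Const (Poly_Mapping.lookup p (Poly_Mapping.single v 1)) * Var v)"
    by (intro linear_form_expansion) auto
  then show ?thesis by auto
qed

lemma bihomog_0_1_expansion:
  assumes "bihomog 0 1 p"
  shows "\<exists>c. p = (\<Sum>v\<in>{X, Y, Z}. Const (c v) * Var v)"
proof -
  have "\<exists>v\<in>{X, Y, Z}. mo = Poly_Mapping.single v 1" if "mo \<in> Poly_Mapping.keys p" for mo
  proof -
    let ?k = "Poly_Mapping.lookup mo"
    have "?k S + ?k T = 0" "?k X + ?k Y + ?k Z = 1" using assms that by (auto simp: bihomog_def)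
    then consider "?k S = 0" "?k T = 0" "?k X = 1" "?k Y = 0" "?k Z = 0"
      | "?k S = 0" "?k T = 0" "?k X = 0" "?k Y = 1" "?k Z = 0"
      | "?k S = 0" "?k T = 0" "?k X = 0" "?k Y = 0" "?k Z = 1" by linarith
    then show ?thesis
    proof cases
      case 1
      then have "mo = Poly_Mapping.single X 1"
        by (intro monomial_eq_single) (metis var.exhaust)+
      then show ?thesis by blast
    next
      case 2
      then have "mo = Poly_Mapping.single Y 1"
        by (intro monomial_eq_single) (metis var.exhaust)+
      then show ?thesis by blast
    next
      case 3
      then have "mo = Poly_Mapping.single Z 1"
        by (intro monomial_eq_single) (metis var.exhaust)+
      then show ?thesis by blast
    qed
  qed
  then have "p = (\<Sum>v\<in>{X, Y, Z}. Const (Poly_Mapping.lookup p (Poly_Mapping.single v 1)) * Var v)"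
    by (intro linear_form_expansion) auto
  then show ?thesis by (rule exI[of _ "\<lambda>v. Poly_Mapping.lookup p (Poly_Mapping.single v 1)"])
qed

lemma is_hom_eval5: "is_hom (\<lambda>p. eval5 p pt)"
  unfolding eval5_eq_psubst by (rule is_hom_psubst) (simp add: is_hom_def)

lemma eval5_Const: "eval5 (Const c) pt = c" and eval5_Var: "eval5 (Var v) pt = pt v"
  unfolding eval5_eq_psubst by (simp_all add: psubst_Const psubst_Var is_hom_def)

lemmas eval5_simps = is_hom_add[OF is_hom_eval5] is_hom_mult[OF is_hom_eval5] eval5_Const eval5_Var

lemma bizero_scale:
  assumes "(c :: 'k::field) \<noteq> 0"
  shows "bizero {Const c * p} = bizero {p}"
  using assms by (simp add: bizero_def eval5_simps)

text \<open>Serves in contrapositive form: different zero loci force different slopes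
  \<open>a i\<close> or \<open>b i\<close>.\<close>

lemma bizero_proportional:
  assumes "p = Const (c :: 'k::field) * f" "q = Const d * f" "c \<noteq> 0" "d \<noteq> 0"
  shows "bizero {p} = bizero {q}"
  using assms by (simp add: bizero_scale)

text \<open>Each pair excludes at most one ratio, and a field of characteristic zero is
  infinite.\<close>

lemma avoid_finitely_many_ratios:
  fixes f g :: "nat \<Rightarrow> 'k::field_char_0"
  assumes "\<And>i. i \<in> N \<Longrightarrow> f i \<noteq> 0 \<or> g i \<noteq> 0" "finite N"
  obtains c where "\<And>i. i \<in> N \<Longrightarrow> g i - c * f i \<noteq> 0"
proof -
  obtain c where c: "c \<notin> (\<lambda>i. g i / f i) ` N"
    using assms(2) infinite_UNIV_char_0 ex_new_if_finite finite_imageI by metis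
  have "g i - c * f i \<noteq> 0" if i: "i \<in> N" for i
  proof
    assume eq: "g i - c * f i = 0"
    then have "f i \<noteq> 0" using assms(1)[OF i] by auto
    then have "c = g i / f i" using eq by (simp add: field_simps)
    then show False using c i by blast
  qed
  then show ?thesis by (rule that)
qed

text \<open>Two distinct lines of the projective plane meet; a vanishing cross product would make
  the two forms proportional. The coordinate \<open>p S = 1\<close> supplies the point of the
  projective line that \<open>bizero\<close> also requires.\<close>

lemma common_point:
  fixes c d :: "var \<Rightarrow> 'k::field"
  assumes "(\<Sum>v\<in>{X, Y, Z}. Const (c v) * Var v) \<noteq> 0" "(\<Sum>v\<in>{X, Y, Z}. Const (d v) * Var v) \<noteq> 0"
    and ne: "bizero {\<Sum>v\<in>{X, Y, Z}. Const (c v) * Var v} \<noteq> bizero {\<Sum>v\<in>{X, Y, Z}. Const (d v) * Var v}"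
  obtains p where "p S = 1" "p X \<noteq> 0 \<or> p Y \<noteq> 0 \<or> p Z \<noteq> 0"
    "(\<Sum>v\<in>{X, Y, Z}. c v * p v) = 0" "(\<Sum>v\<in>{X, Y, Z}. d v * p v) = 0"
proof -
  \<comment> \<open>on \<open>X, Y, Z\<close>, the cross product of the coefficient vectors\<close>
  define p where "p = (\<lambda>v. case v of S \<Rightarrow> 1 | T \<Rightarrow> 0 | X \<Rightarrow> c Y * d Z - c Z * d Y
    | Y \<Rightarrow> c Z * d X - c X * d Z | Z \<Rightarrow> c X * d Y - c Y * d X)"
  have "p X \<noteq> 0 \<or> p Y \<noteq> 0 \<or> p Z \<noteq> 0"
  proof (rule ccontr)
    assume "\<not> ?thesis"
    then have par: "c u * d v = c v * d u" if "u \<in> {X, Y, Z}" "v \<in> {X, Y, Z}" for u v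
      using that by (auto simp: p_def)
    have "d X \<noteq> 0 \<or> d Y \<noteq> 0 \<or> d Z \<noteq> 0" using assms(2) by auto
    then obtain u where u: "u \<in> {X, Y, Z}" "d u \<noteq> 0" by blast
    define r where "r = c u / d u"
    have r: "c v = r * d v" if "v \<in> {X, Y, Z}" for v
      using par[OF u(1) that] u(2) by (simp add: r_def field_simps)
    then have eq: "(\<Sum>v\<in>{X, Y, Z}. Const (c v) * Var v) = Const r * (\<Sum>v\<in>{X, Y, Z}. Const (d v) * Var v)"
      by (simp add: Const_mult distrib_left ac_simps)
    then have "r \<noteq> 0" using assms(1) by auto
    then show False using ne bizero_scale unfolding eq by blast
  qed
  moreover have "(\<Sum>v\<in>{X, Y, Z}. c v * p v) = 0" "(\<Sum>v\<in>{X, Y, Z}. d v * p v) = 0"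
    by (simp_all add: p_def algebra_simps)
  moreover have "p S = 1" by (simp add: p_def)
  ultimately show ?thesis by (intro that)
qed

theorem theorem4p15:
  fixes A B :: "nat \<Rightarrow> ('k::field_char_0) mpoly5" and n m :: nat
  assumes "n \<ge> 2"
    and "\<forall>i\<in>{1..n}. bihomog 1 0 (A i) \<and> A i \<noteq> 0"
    and "\<forall>i\<in>{1..n}. bihomog 0 1 (B i) \<and> B i \<noteq> 0"
    and "bizero {A (n - 1)} \<noteq> bizero {A n}"
    and "\<forall>i\<in>{1..n}. \<forall>j\<in>{1..n}. i \<noteq> j \<longrightarrow> bizero {B i} \<noteq> bizero {B j}"
    and "bizero (B ` {1..n}) = bizero {B 1, B 2}"
  shows "cohen_macaulay_quot
           ((\<Inter>i\<in>{1..n}. gen_ideal {A i, B i}) \<inter> ideal_pow (gen_ideal {B 1, B 2}) m)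
         \<longleftrightarrow> m \<ge> n - 1"
proof -
  have "\<forall>i. \<exists>c c'. i \<in> {1..n} \<longrightarrow> A i = Const c * Var S + Const c' * Var T"
    using assms(2) bihomog_1_0_expansion by blast
  then obtain \<alpha> \<alpha>' where A: "\<And>i. i \<in> {1..n} \<Longrightarrow> A i = Const (\<alpha> i) * Var S + Const (\<alpha>' i) * Var T"
    by metis
  have "\<forall>i. \<exists>c. i \<in> {1..n} \<longrightarrow> B i = (\<Sum>v\<in>{X, Y, Z}. Const (c v) * Var v)"
    using assms(3) bihomog_0_1_expansion by blast
  then obtain \<beta> where B: "\<And>i. i \<in> {1..n} \<Longrightarrow> B i = (\<Sum>v\<in>{X, Y, Z}. Const (\<beta> i v) * Var v)"
    by metis
  have idx: "1 \<in> {1..n}" "2 \<in> {1..n}" "1 \<noteq> (2::nat)" "n - 1 \<in> {1..n}" "n \<in> {1..n}" using assms(1) by auto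
  have evB: "eval5 (B i) pt = (\<Sum>v\<in>{X, Y, Z}. \<beta> i v * pt v)" if "i \<in> {1..n}" for i pt
    by (simp add: B[OF that] eval5_simps)
  have B12: "B 1 \<noteq> 0" "B 2 \<noteq> 0" "bizero {B 1} \<noteq> bizero {B 2}" using assms(3,5) idx by blast+
  obtain p where p: "p S = 1" "p X \<noteq> 0 \<or> p Y \<noteq> 0 \<or> p Z \<noteq> 0"
    "(\<Sum>v\<in>{X, Y, Z}. \<beta> 1 v * p v) = 0" "(\<Sum>v\<in>{X, Y, Z}. \<beta> 2 v * p v) = 0"
    using common_point[OF B12[unfolded B[OF idx(1)] B[OF idx(2)]]] by blast
  have "eval5 (B 1) p = 0" "eval5 (B 2) p = 0"
    unfolding evB[OF idx(1)] evB[OF idx(2)] by (fact p)+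
  then have "p \<in> bizero {B 1, B 2}"
    using p(1,2) by (simp add: bizero_def)
  \<comment> \<open>Equality of the zero loci acts here: the common point of the first two lines
    lies on all of them, so all coefficient vectors satisfy one linear relation, that is, every
    \<open>B i\<close> is in the span of \<open>B 1\<close> and \<open>B 2\<close>.\<close>
  then have "p \<in> bizero (B ` {1..n})" using assms(6) by simp
  then have pB: "(\<Sum>v\<in>{X, Y, Z}. \<beta> i v * p v) = 0" if "i \<in> {1..n}" for i
    using that evB[OF that, of p] by (auto simp: bizero_def)
  \<comment> \<open>\<open>v0\<close> is a coordinate not vanishing at \<open>p\<close>. Normalising
    by it turns \<open>p\<close> into \<open>(1 : q1 : q2)\<close> and expresses the coefficient at
    \<open>v0\<close> through the other two.\<close>
  obtain v0 v1 v2 where v: "p v0 \<noteq> 0" "{v0, v1, v2} = {X, Y, Z}" "distinct [S, T, v0, v1, v2]"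
  proof -
    from p(2) consider "p X \<noteq> 0" | "p Y \<noteq> 0" | "p Z \<noteq> 0" by blast
    then show ?thesis
      by cases (rule that[of X Y Z] that[of Y X Z] that[of Z X Y]; auto)+
  qed
  have UNIV: "UNIV = {S, T, v0, v1, v2}" using v(2) UNIV_var by auto
  have sumv: "(\<Sum>v\<in>{X, Y, Z}. h v) = h v0 + h v1 + h v2" for h :: "var \<Rightarrow> 'c::comm_monoid_add"
    unfolding v(2)[symmetric] using v(3) by (simp add: add.assoc)
  define q1 where "q1 = p v1 / p v0"
  define q2 where "q2 = p v2 / p v0"
  have \<beta>0: "\<beta> i v0 = - (\<beta> i v1 * q1 + \<beta> i v2 * q2)" if "i \<in> {1..n}" for i
    using pB[OF that] v(1) unfolding sumv q1_def q2_def
    by (simp add: field_simps) (simp add: eq_neg_iff_add_eq_0 add.commute add.left_commute)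
  have "\<alpha> i \<noteq> 0 \<or> \<alpha>' i \<noteq> 0" if "i \<in> {1..n}" for i
    using assms(2) that A[OF that] by auto
  then obtain la where la: "\<And>i. i \<in> {1..n} \<Longrightarrow> \<alpha>' i - la * \<alpha> i \<noteq> 0"
    using avoid_finitely_many_ratios[of "{1..n}" \<alpha> \<alpha>'] by blast
  have "\<beta> i v1 \<noteq> 0 \<or> \<beta> i v2 \<noteq> 0" if "i \<in> {1..n}" for i
    using assms(3) that B[OF that] \<beta>0[OF that] by (auto simp: sumv)
  then obtain mu where mu: "\<And>i. i \<in> {1..n} \<Longrightarrow> \<beta> i v2 - mu * \<beta> i v1 \<noteq> 0"
    using avoid_finitely_many_ratios[of "{1..n}" "\<lambda>i. \<beta> i v1" "\<lambda>i. \<beta> i v2"] by blast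
  interpret frame v0 v1 v2 q1 q2 la mu
    by unfold_locales (fact UNIV v(3))+
  \<comment> \<open>In the new coordinates the forms read \<open>\<alpha> i * l + d i * t\<close>
    and \<open>\<beta> i v1 * x + g i * y\<close>. The choice of \<open>la\<close> and
    \<open>mu\<close> makes \<open>d i\<close> and \<open>g i\<close> invertible, and dividing by
    them leaves the slopes \<open>a i\<close> and \<open>b i\<close>.\<close>
  define d where "d = (\<lambda>i. \<alpha>' i - la * \<alpha> i)"
  define g where "g = (\<lambda>i. \<beta> i v2 - mu * \<beta> i v1)"
  define a where "a = (\<lambda>i. - \<alpha> i / d i)"
  define b where "b = (\<lambda>i. - \<beta> i v1 / g i)"
  have Ai: "A i = Const (d i) * (t - Const (a i) * l)" if i: "i \<in> {1..n}" for i
  proof -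
    have "d i * a i = - \<alpha> i" using la[OF i] by (simp add: a_def d_def)
    then have "Const (d i) * Const (a i) = - Const (\<alpha> i)" by (simp add: Const_mult[symmetric] Const_minus)
    then have "Const (d i) * (t - Const (a i) * l) = Const (d i) * t + Const (\<alpha> i) * l"
      by (simp add: right_diff_distrib mult.assoc[symmetric])
    also have "\<dots> = A i"
      by (simp add: A[OF i] d_def l_def t_def Const_diff Const_mult algebra_simps)
    finally show ?thesis ..
  qed
  have Bi: "B i = Const (g i) * (y - Const (b i) * x)" if i: "i \<in> {1..n}" for i
  proof -
    have "g i * b i = - \<beta> i v1" using mu[OF i] by (simp add: b_def g_def)
    then have "Const (g i) * Const (b i) = - Const (\<beta> i v1)" by (simp add: Const_mult[symmetric] Const_minus)
    then have "Const (g i) * (y - Const (b i) * x) = Const (g i) * y + Const (\<beta> i v1) * x"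
      by (simp add: right_diff_distrib mult.assoc[symmetric])
    moreover have "B i = Const (g i) * y + Const (\<beta> i v1) * x"
    proof -
      have eqs: "Const (g i) = Const (\<beta> i v2) - Const mu * Const (\<beta> i v1)"
        "Const (\<beta> i v0) = - (Const (\<beta> i v1) * Const q1 + Const (\<beta> i v2) * Const q2)"
        unfolding \<beta>0[OF i] g_def by (simp_all only: Const_diff Const_mult Const_minus Const_add)
      have "B i = Const (\<beta> i v0) * z + Const (\<beta> i v1) * ((x - Const mu * y) + Const q1 * z)
          + Const (\<beta> i v2) * (y + Const q2 * z)"
        unfolding B[OF i] sumv Var_eqs ..
      then show ?thesis unfolding eqs by (simp add: algebra_simps)
    qed
    ultimately show ?thesis by simp
  qed
  interpret configuration v0 v1 v2 q1 q2 la mu a b n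
  proof unfold_locales
    show "inj_on b {1..n}"
    proof (rule inj_onI, rule ccontr)
      fix i j assume ij: "i \<in> {1..n}" "j \<in> {1..n}" "b i = b j" "i \<noteq> j"
      then have "bizero {B i} = bizero {B j}"
        using Bi[of i] Bi[of j] mu[of i] mu[of j]
        by (intro bizero_proportional[of _ "g i" "y - Const (b i) * x" _ "g j"]) (auto simp: g_def)
      then show False using assms(5) ij by blast
    qed
    show "a (n - 1) \<noteq> a n"
    proof
      assume "a (n - 1) = a n"
      then have "bizero {A (n - 1)} = bizero {A n}"
        using Ai[OF idx(4)] Ai[OF idx(5)] la[OF idx(4)] la[OF idx(5)]
        by (intro bizero_proportional[of _ "d (n - 1)" "t - Const (a n) * l" _ "d n"]) (auto simp: d_def)
      then show False using assms(4) by blast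
    qed
  qed (fact assms(1))
  have "(\<Inter>i\<in>{1..n}. gen_ideal {A i, B i}) \<inter> ideal_pow (gen_ideal {B 1, B 2}) m = II m"
    by (rule intersection_eq_II[where d = d and g = g]) (use Ai Bi la mu in \<open>auto simp: d_def g_def\<close>)
  then show ?thesis by (simp only: cohen_macaulay_II_iff)
qed

end
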